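(* Let $\alpha = \frac{1-\ln(2)}{2} \approx \frac{1}{6.52}$. There exists an $\alpha$-competitive randomized algorithm for the generalized assignment problem in the random-order model.
   Context: Generalized assignment problem (GAP): there are bins $[m]=\{1,\dots,m\}$ with capacities $C_i>0$ and items $[n]$; assigning item $j$ to bin $i$ uses size $s_{i,j}>0$ of bin $i$ and yields value $v_{i,j}>0$. A (feasible) assignment is $\mathbf{x}\in\{0,1\}^{m\times n}$ with $\sum_{j=1}^n s_{i,j}x_{i,j}\le C_i$ for all $i\in[m]$ and $\sum_{i=1}^m x_{i,j}\le 1$ for all $j\in[n]$; its value is $v(\mathbf{x})=\sum_{i,j} v_{i,j}x_{i,j}$. Let $\mathbf{x}^*$ be an optimal (offline) feasible assignment. Random-order model: the algorithm knows $n$, the bins and capacities, but the values and sizes $(v_{i,j},s_{i,j})_{i\in[m]}$ of an item $j$ are revealed only when the item arrives; items arrive in rounds $1,\dots,n$ in the order $\pi(1),\dots,\pi(n)$ given by a permutation $\pi$ of $[n]$ drawn uniformly at random, and upon arrival of an item the algorithm must decide immediately and irrevocably to which bin (if any) to assign it, keeping the assignment feasible. An algorithm is $\alpha$-competitive if for every instance its output $\mathbf{x}$ satisfies $\mathbb{E}[v(\mathbf{x})]\ge(\alpha-o(1))\,v(\mathbf{x}^* )$, where the expectation is over the random permutation and the algorithm's internal randomness, and $o(1)$ is with respect to $n\to\infty$. *)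

theory Defs
  imports "HOL-Probability.Probability" "HOL-Library.Landau_Symbols"
begin

section \<open>The generalized assignment problem\<close>

text \<open>
  Bins are \<open>{1..bins I}\<close> and items are \<open>{1..items I}\<close>; in \<open>weight I i j\<close> (the size \<open>s\<^sub>i\<^sub>j\<close>) and
  \<open>worth I i j\<close> (the value \<open>v\<^sub>i\<^sub>j\<close>) the bin index comes first. Data outside these index ranges
  are irrelevant.
\<close>

record gap =
  bins :: nat
  items :: nat
  capacity :: "nat \<Rightarrow> real"
  weight :: "nat \<Rightarrow> nat \<Rightarrow> real"
  worth :: "nat \<Rightarrow> nat \<Rightarrow> real"

definition gap_instance :: "gap \<Rightarrow> bool" where
  "gap_instance I \<longleftrightarrow>
     (\<forall>i\<in>{1..bins I}. capacity I i > 0) \<and>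
     (\<forall>i\<in>{1..bins I}. \<forall>j\<in>{1..items I}. weight I i j > 0 \<and> worth I i j > 0)"

type_synonym assignment = "nat \<Rightarrow> nat \<Rightarrow> real"

definition feasible :: "gap \<Rightarrow> assignment \<Rightarrow> bool" where
  "feasible I x \<longleftrightarrow>
     (\<forall>i\<in>{1..bins I}. \<forall>j\<in>{1..items I}. x i j \<in> {0, 1}) \<and>
     (\<forall>i\<in>{1..bins I}. (\<Sum>j=1..items I. weight I i j * x i j) \<le> capacity I i) \<and>
     (\<forall>j\<in>{1..items I}. (\<Sum>i=1..bins I. x i j) \<le> 1)"

definition assignment_value :: "gap \<Rightarrow> assignment \<Rightarrow> real" where
  "assignment_value I x = (\<Sum>i=1..bins I. \<Sum>j=1..items I. worth I i j * x i j)"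

definition optimal :: "gap \<Rightarrow> assignment \<Rightarrow> bool" where
  "optimal I x \<longleftrightarrow>
     feasible I x \<and> (\<forall>y. feasible I y \<longrightarrow> assignment_value I y \<le> assignment_value I x)"


section \<open>Randomized online algorithms in the random-order model\<close>

text \<open>
  What is revealed when an item arrives: the list of its (value, size) pairs for bins
  \<open>1, \<dots>, m\<close>. The label of the item is not revealed.
\<close>

type_synonym profile = "(real \<times> real) list"

definition item_profile :: "gap \<Rightarrow> nat \<Rightarrow> profile" where
  "item_profile I j = map (\<lambda>i. (worth I i j, weight I i j)) [1..<Suc (bins I)]"

text \<open>
  The outcome of one round: a private random value, which the algorithm may remember and use in
  later rounds, and the irrevocable decision, where \<open>Some i\<close> puts the arriving item into bin \<open>i\<close>
  and \<open>None\<close> (or a number that is not a bin) rejects it.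
\<close>

type_synonym outcome = "nat \<times> nat option"

text \<open>
  A randomized online algorithm maps the number of items, the list of capacities (whose length is
  the number of bins), the profiles of the items that have arrived so far including the current
  one, and its own outcomes in all earlier rounds to the distribution of the outcome of the
  current round.
\<close>

type_synonym algorithm =
  "nat \<Rightarrow> real list \<Rightarrow> profile list \<Rightarrow> outcome list \<Rightarrow> outcome pmf"

text \<open>The outcomes of the first \<open>k\<close> rounds when item \<open>\<pi> l\<close> arrives in round \<open>l\<close>.\<close>

primrec run :: "algorithm \<Rightarrow> gap \<Rightarrow> (nat \<Rightarrow> nat) \<Rightarrow> nat \<Rightarrow> outcome list pmf" where
  "run A I \<pi> 0 = return_pmf []"
| "run A I \<pi> (Suc k) =
     bind_pmf (run A I \<pi> k) (\<lambda>h.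
       map_pmf (\<lambda>d. h @ [d])
         (A (items I) (map (capacity I) [1..<Suc (bins I)])
            (map (\<lambda>l. item_profile I (\<pi> l)) [1..<Suc (Suc k)]) h))"

text \<open>List positions start at 0, so round \<open>l\<close> is recorded at position \<open>l - 1\<close>.\<close>

definition assignment_of :: "gap \<Rightarrow> (nat \<Rightarrow> nat) \<Rightarrow> outcome list \<Rightarrow> assignment" where
  "assignment_of I \<pi> h =
     (\<lambda>i j. if \<exists>l\<in>{1..items I}. \<pi> l = j \<and> snd (h ! (l - 1)) = Some i then 1 else 0)"

definition arrival_order :: "nat \<Rightarrow> (nat \<Rightarrow> nat) pmf" where
  "arrival_order n = pmf_of_set {\<pi>. \<pi> permutes {1..n}}"

definition final_assignment :: "algorithm \<Rightarrow> gap \<Rightarrow> assignment pmf" where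
  "final_assignment A I =
     bind_pmf (arrival_order (items I)) (\<lambda>\<pi>.
       map_pmf (assignment_of I \<pi>) (run A I \<pi> (items I)))"

text \<open>
  Since all sizes are positive, feasibility of the final assignment is the same as feasibility
  after every round.
\<close>

definition always_feasible :: "algorithm \<Rightarrow> bool" where
  "always_feasible A \<longleftrightarrow> (\<forall>I. gap_instance I \<longrightarrow> (\<forall>x\<in>set_pmf (final_assignment A I). feasible I x))"

text \<open>
  The error term depends on the number of items only: it is uniform in the number of bins, the
  capacities, the sizes and the values.
\<close>

definition competitive :: "real \<Rightarrow> algorithm \<Rightarrow> bool" where
  "competitive \<alpha> A \<longleftrightarrow>
     (\<exists>\<epsilon> :: nat \<Rightarrow> real. \<epsilon> \<in> o(\<lambda>_. 1) \<and>
        (\<forall>I x_opt. gap_instance I \<and> optimal I x_opt \<longrightarrow>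
           measure_pmf.expectation (final_assignment A I) (assignment_value I)
             \<ge> (\<alpha> - \<epsilon> (items I)) * assignment_value I x_opt))"

end

theory Submission
  imports Defs
begin

text \<open>
  The first \<open>\<lfloor>n/2\<rfloor>\<close> items are only observed. In every later round \<open>l\<close> an optimal integral packing of
  the \<open>l\<close> items seen so far proposes a tentative bin for the current item. Given the set of these
  items, the current one is uniformly distributed among them, so its expected value is at least
  \<open>OPT/n\<close> and the expected size that it brings to bin \<open>i\<close> is at most \<open>C\<^sub>i/l\<close>. By Markov's inequality
  the virtual load of bin \<open>i\<close> (the total size of all items tentatively sent to it) is still below
  \<open>C\<^sub>i\<close> in round \<open>l\<close> with probability at least \<open>1 - (1/(r+1) + \<dots> + 1/(l-1))\<close> where \<open>r = \<lfloor>n/2\<rfloor>\<close>, even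
  conditioned on the current item. The tentative items that find the virtual load below the
  capacity overfill the bin by at most one item; a fair coin, flipped once, decides whether to keep
  the items that fit or only the one that exceeds the capacity, which costs a factor \<open>1/2\<close>. Summing
  over the rounds gives \<open>OPT/2\<close> times \<open>\<integral>(2 - 1/t) dt = 1 - ln 2\<close>, integrated from \<open>1/2\<close> to \<open>1\<close>.
\<close>

section \<open>Optimal packings of the observed items\<close>

definition p_value :: "profile \<Rightarrow> nat \<Rightarrow> real" where
  "p_value p i = fst (p ! (i - 1))"

definition p_size :: "profile \<Rightarrow> nat \<Rightarrow> real" where
  "p_size p i = snd (p ! (i - 1))"

abbreviation cap_list :: "gap \<Rightarrow> real list" where
  "cap_list I \<equiv> map (capacity I) [1..<Suc (bins I)]"

lemma profile_simps [simp]: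
  assumes "i \<in> {1..bins I}"
  shows "p_value (item_profile I j) i = worth I i j"
    and "p_size (item_profile I j) i = weight I i j"
    and "cap_list I ! (i - 1) = capacity I i"
  using assms by (auto simp: p_value_def p_size_def item_profile_def nth_upt simp del: upt_Suc)

text \<open>A packing sends list positions to bins, and bin 0 stands for rejection. Extensionality
  outside the positions keeps the set of packings finite.\<close>

definition packings :: "real list \<Rightarrow> profile list \<Rightarrow> (nat \<Rightarrow> nat) set" where
  "packings C ps = {b \<in> {..<length ps} \<rightarrow>\<^sub>E {..length C}.
     \<forall>i\<in>{1..length C}. (\<Sum>k | k < length ps \<and> b k = i. p_size (ps ! k) i) \<le> C ! (i - 1)}"

definition packing_value :: "real list \<Rightarrow> profile list \<Rightarrow> (nat \<Rightarrow> nat) \<Rightarrow> real" where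
  "packing_value C ps b =
     (\<Sum>i=1..length C. \<Sum>k | k < length ps \<and> b k = i. p_value (ps ! k) i)"

definition best_packing :: "real list \<Rightarrow> profile list \<Rightarrow> nat \<Rightarrow> nat" where
  "best_packing C ps = (SOME b. b \<in> packings C ps \<and>
     (\<forall>b'\<in>packings C ps. packing_value C ps b' \<le> packing_value C ps b))"

lemma best_packing:
  assumes "\<And>i. i \<in> {1..length C} \<Longrightarrow> C ! (i - 1) \<ge> 0"
  shows "best_packing C ps \<in> packings C ps"
    and "b \<in> packings C ps \<Longrightarrow> packing_value C ps b \<le> packing_value C ps (best_packing C ps)"
proof -
  have fin: "finite (packings C ps)"
    unfolding packings_def by (rule finite_subset[OF _ finite_PiE[of "{..<length ps}" "\<lambda>_. {..length C}"]]) auto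
  \<comment> \<open>The packing that rejects everything has all loads 0, so nonnegative capacities
    make the set of packings nonempty.\<close>
  define z :: "nat \<Rightarrow> nat" where "z = restrict (\<lambda>_. 0) {..<length ps}"
  have z: "(\<Sum>k | k < length ps \<and> z k = i. p_size (ps ! k) i) \<le> C ! (i - 1)"
    if "i \<in> {1..length C}" for i
  proof -
    have "{k. k < length ps \<and> z k = i} = {}"
      using that by (auto simp: z_def)
    show ?thesis using assms[OF that] unfolding \<open>_ = {}\<close> by simp
  qed
  have "z \<in> {..<length ps} \<rightarrow>\<^sub>E {..length C}" by (auto simp: z_def)
  with z have "z \<in> packings C ps"
    unfolding packings_def by blast
  then have ne: "packings C ps \<noteq> {}" by blast
  have "\<exists>b. b \<in> packings C ps \<and>
     (\<forall>b'\<in>packings C ps. packing_value C ps b' \<le> packing_value C ps b)"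
  proof -
    have fin': "finite (packing_value C ps ` packings C ps)" using fin by simp
    have "Max (packing_value C ps ` packings C ps) \<in> packing_value C ps ` packings C ps"
      using fin' ne by (intro Max_in) auto
    then obtain b where b: "b \<in> packings C ps"
      "packing_value C ps b = Max (packing_value C ps ` packings C ps)" by force
    have "packing_value C ps b' \<le> packing_value C ps b" if "b' \<in> packings C ps" for b'
      unfolding b(2) using fin' that by (intro Max_ge) auto
    with b(1) show ?thesis by blast
  qed
  from someI_ex[OF this] show "best_packing C ps \<in> packings C ps"
    and "b \<in> packings C ps \<Longrightarrow> packing_value C ps b \<le> packing_value C ps (best_packing C ps)"
    unfolding best_packing_def by blast+
qed

section \<open>Packings that do not depend on the arrival order\<close>

definition canonical :: "'a multiset \<Rightarrow> 'a list" where
  "canonical M = (SOME xs. mset xs = M)"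

lemma mset_canonical [simp]: "mset (canonical M) = M"
  unfolding canonical_def by (rule someI_ex) (rule ex_mset)

lemma length_canonical [simp]: "length (canonical M) = size M"
  by (metis mset_canonical size_mset)

text \<open>The canonical list is a rearrangement of \<open>ps\<close>. Carrying \<open>b\<close>
  along the rearranging permutation changes neither bin loads nor value, so optimality on the
  canonical list covers packings of the list in arrival order.\<close>

lemma best_packing_canonical_ge:
  assumes "\<And>i. i \<in> {1..length C} \<Longrightarrow> C ! (i - 1) \<ge> 0"
    and "b \<in> {..<length ps} \<rightarrow> {..length C}"
    and "\<And>i. i \<in> {1..length C} \<Longrightarrow>
      (\<Sum>k | k < length ps \<and> b k = i. p_size (ps ! k) i) \<le> C ! (i - 1)"
  shows "packing_value C ps b \<le> packing_value C (canonical (mset ps)) (best_packing C (canonical (mset ps)))"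
proof -
  obtain f where f: "f permutes {..<length ps}" "permute_list f ps = canonical (mset ps)"
    using mset_eq_permutation[of "canonical (mset ps)" ps] by auto
  define L where "L = canonical (mset ps)"
  have len: "length L = length ps" by (simp add: L_def)
  have nth: "L ! k = ps ! f k" if "k < length ps" for k
    using permute_list_nth[OF f(1) that] f(2) by (simp add: L_def)
  define b' where "b' = restrict (b \<circ> f) {..<length ps}"
  have f_lt: "f k < length ps \<longleftrightarrow> k < length ps" for k
    using permutes_in_image[OF f(1), of k] by simp
  \<comment> \<open>Stated for arbitrary \<open>g\<close>, so that it serves for sizes (membership
    in \<open>packings\<close>) and for values alike.\<close>
  have tr: "(\<Sum>k | k < length L \<and> b' k = i. g (L ! k)) = (\<Sum>k | k < length ps \<and> b k = i. g (ps ! k))"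
    for i and g :: "profile \<Rightarrow> real"
  proof -
    have "bij_betw f {k. k < length L \<and> b' k = i} {k. k < length ps \<and> b k = i}"
    proof (rule bij_betw_imageI)
      show "inj_on f {k. k < length L \<and> b' k = i}"
        using permutes_inj[OF f(1)] by (rule inj_on_subset) simp
      have "k \<in> f ` {k. k < length L \<and> b' k = i}" if "k < length ps" "b k = i" for k
      proof -
        have "f (inv f k) = k" using permutes_inverses(1)[OF f(1)] .
        moreover from this have "inv f k < length ps" using that f_lt[of "inv f k"] by simp
        ultimately show ?thesis
          using that by (intro image_eqI[of _ _ "inv f k"]) (simp_all add: len b'_def)
      qed
      then show "f ` {k. k < length L \<and> b' k = i} = {k. k < length ps \<and> b k = i}"
        by (auto simp: len b'_def f_lt)
    qed
    from sum.reindex_bij_betw[OF this, of "\<lambda>k. g (ps ! k)"] show ?thesis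
      by (simp add: len nth)
  qed
  have "b' \<in> {..<length L} \<rightarrow>\<^sub>E {..length C}"
    using assms(2) by (auto simp: len b'_def f_lt)
  moreover have "(\<Sum>k | k < length L \<and> b' k = i. p_size (L ! k) i) \<le> C ! (i - 1)" if "i \<in> {1..length C}" for i
    using assms(3)[OF that] by (subst tr[where g = "\<lambda>p. p_size p i"])
  ultimately have "b' \<in> packings C L"
    unfolding packings_def by blast
  from best_packing(2)[OF assms(1) this]
  have "packing_value C L b' \<le> packing_value C L (best_packing C L)" .
  moreover have "packing_value C L b' = packing_value C ps b"
    unfolding packing_value_def by (intro sum.cong refl tr)
  ultimately show ?thesis by (simp only: L_def)
qed

text \<open>Averaging over the fibres of \<open>g\<close> preserves the sum: after exchanging the
  sums, \<open>f k'\<close> is counted once for each member of its fibre, each time divided by the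
  size of that fibre.\<close>

lemma sum_average_over_fibres:
  fixes f :: "nat \<Rightarrow> real"
  shows "(\<Sum>k<n. (\<Sum>k' | k' < n \<and> g k' = g k. f k') / card {k'. k' < n \<and> g k' = g k}) = (\<Sum>k<n. f k)"
proof -
  \<comment> \<open>Writing the denominator as the fibre size of \<open>k'\<close> makes it constant
    in the inner sum once the sums are exchanged.\<close>
  have "(\<Sum>k<n. (\<Sum>k' | k' < n \<and> g k' = g k. f k') / card {k'. k' < n \<and> g k' = g k})
      = (\<Sum>k<n. \<Sum>k'<n. if g k' = g k then f k' / card {j. j < n \<and> g j = g k'} else 0)"
  proof (rule sum.cong[OF refl])
    fix k
    have "(\<Sum>k' | k' < n \<and> g k' = g k. f k') / card {k'. k' < n \<and> g k' = g k}
      = (\<Sum>k' | k' < n \<and> g k' = g k. f k' / card {j. j < n \<and> g j = g k'})"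
      by (simp add: sum_divide_distrib)
    also have "\<dots> = (\<Sum>k'<n. if g k' = g k then f k' / card {j. j < n \<and> g j = g k'} else 0)"
      by (subst sum.inter_filter[symmetric]) auto
    finally show "(\<Sum>k' | k' < n \<and> g k' = g k. f k') / card {k'. k' < n \<and> g k' = g k} = \<dots>" .
  qed
  also have "\<dots> = (\<Sum>k'<n. \<Sum>k<n. if g k' = g k then f k' / card {j. j < n \<and> g j = g k'} else 0)"
    by (rule sum.swap)
  also have "\<dots> = (\<Sum>k'<n. f k')"
  proof (rule sum.cong[OF refl])
    fix k' assume k': "k' \<in> {..<n}"
    have "(\<Sum>k<n. if g k' = g k then f k' / card {j. j < n \<and> g j = g k'} else 0)
      = (\<Sum>k | k \<in> {..<n} \<and> g k' = g k. f k' / card {j. j < n \<and> g j = g k'})"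
      by (subst sum.inter_filter[symmetric]) auto
    also have "\<dots> = (\<Sum>k | k < n \<and> g k = g k'. f k' / card {j. j < n \<and> g j = g k'})"
      by (rule sum.cong) auto
    also have "\<dots> = f k'"
      using k' by auto
    finally show "(\<Sum>k<n. if g k' = g k then f k' / card {j. j < n \<and> g j = g k'} else 0) = f k'" .
  qed
  finally show ?thesis .
qed

text \<open>
  Items are seen without labels, so equal profiles cannot be told apart. The packing therefore
  depends on the multiset of profiles only, and the current item takes the role of a uniformly
  random copy of its profile.
\<close>

definition tentative :: "real list \<Rightarrow> profile multiset \<Rightarrow> profile \<Rightarrow> nat pmf" where
  "tentative C M p = map_pmf (best_packing C (canonical M))
     (pmf_of_set {k. k < size M \<and> canonical M ! k = p})"

lemma tentative_index_set:
  assumes "p \<in># M"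
  shows "finite {k. k < size M \<and> canonical M ! k = p}" "{k. k < size M \<and> canonical M ! k = p} \<noteq> {}"
proof -
  have "p \<in> set (canonical M)" using assms by (metis mset_canonical set_mset_mset)
  then show "{k. k < size M \<and> canonical M ! k = p} \<noteq> {}"
    by (auto simp: in_set_conv_nth)
qed auto

lemma finite_tentative: "p \<in># M \<Longrightarrow> finite (set_pmf (tentative C M p))"
  unfolding tentative_def by (subst set_map_pmf, subst set_pmf_of_set) (auto dest: tentative_index_set)

text \<open>With every item of \<open>M\<close> taking its turn as the current one, the random
  tentative bins reproduce the fixed best packing. The probability for \<open>p\<close> is the share
  of its copies that are packed into bin \<open>i\<close>, and all copies have the same
  \<open>g\<close>, so fibre averaging applies.\<close>

lemma sum_tentative:
  fixes g :: "profile \<Rightarrow> real"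
  shows "(\<Sum>p\<in>#M. pmf (tentative C M p) i * g p) =
    (\<Sum>k | k < size M \<and> best_packing C (canonical M) k = i. g (canonical M ! k))"
proof -
  define L where "L = canonical M"
  define b where "b = best_packing C L"
  have M: "M = mset L" and sz: "size M = length L" by (simp_all add: L_def)
  have "(\<Sum>p\<in>#M. pmf (tentative C M p) i * g p) = (\<Sum>k<length L. pmf (tentative C M (L ! k)) i * g (L ! k))"
    unfolding M mset_map[symmetric] sum_mset_sum_list by (simp add: sum_list_sum_nth atLeast0LessThan)
  also have "\<dots> = (\<Sum>k<length L. (\<Sum>k' | k' < length L \<and> L ! k' = L ! k. of_bool (b k' = i) * g (L ! k'))
      / card {k'. k' < length L \<and> L ! k' = L ! k})"
  proof (rule sum.cong[OF refl])
    fix k assume k: "k \<in> {..<length L}"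
    let ?S = "{k'. k' < length L \<and> L ! k' = L ! k}"
    have S: "finite ?S" "?S \<noteq> {}" using k by auto
    have "pmf (tentative C M (L ! k)) i = measure (pmf_of_set ?S) (b -` {i})"
      unfolding tentative_def sz L_def[symmetric] b_def[symmetric] by (simp add: pmf_map)
    also have "\<dots> = card (?S \<inter> b -` {i}) / card ?S"
      using S by (simp add: measure_pmf_of_set)
    also have "real (card (?S \<inter> b -` {i})) = (\<Sum>k'\<in>?S. of_bool (b k' = i))"
      using S by (simp add: of_bool_def sum.If_cases Int_def vimage_def)
    finally show "pmf (tentative C M (L ! k)) i * g (L ! k)
      = (\<Sum>k'\<in>?S. of_bool (b k' = i) * g (L ! k')) / card ?S"
      by (simp add: sum_distrib_right)
  qed
  also have "\<dots> = (\<Sum>k<length L. of_bool (b k = i) * g (L ! k))"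
    by (rule sum_average_over_fibres)
  also have "\<dots> = (\<Sum>k | k < length L \<and> b k = i. g (L ! k))"
    by (rule sum.mono_neutral_cong_right) auto
  finally show ?thesis by (simp add: L_def b_def)
qed

text \<open>
  The private value \<open>2 * t + b\<close> of a round encodes the tentative bin \<open>t\<close> and a coin \<open>b\<close>. Only the
  coin of round 1 is used.
\<close>

definition draw :: "real list \<Rightarrow> profile multiset \<Rightarrow> profile \<Rightarrow> nat pmf" where
  "draw C M p = map_pmf (\<lambda>(t, b). 2 * t + of_bool b)
     (pair_pmf (tentative C M p) (pmf_of_set (UNIV :: bool set)))"

text \<open>Toggles the lowest bit, which is the coin in the encoding \<open>2 * t + b\<close>, and
  keeps the bin \<open>t\<close>.\<close>

definition flip :: "nat \<Rightarrow> nat" where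
  "flip c = (if even c then c + 1 else c - 1)"

lemma flip_simps [simp]: "flip c div 2 = c div 2" "even (flip c) \<longleftrightarrow> odd c"
  unfolding flip_def by (cases "even c"; simp; presburger)+

text \<open>The coin is fair and independent of the tentative bin.\<close>

lemma flip_draw: "map_pmf flip (draw C M p) = draw C M p"
proof -
  have "map_pmf Not (pmf_of_set (UNIV :: bool set)) = pmf_of_set UNIV"
    by (rule map_pmf_of_set_bij_betw) (auto intro!: bij_betwI[where g = Not])
  moreover have "map_pmf flip (draw C M p) = map_pmf (\<lambda>(t, b). 2 * t + of_bool b)
     (pair_pmf (tentative C M p) (map_pmf Not (pmf_of_set (UNIV :: bool set))))"
    unfolding draw_def pair_map_pmf2 pmf.map_comp
    by (rule map_pmf_cong) (auto simp: flip_def)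
  ultimately show ?thesis by (simp add: draw_def)
qed

lemma draw_div2: "map_pmf (\<lambda>c. c div 2) (draw C M p) = tentative C M p"
proof -
  have "map_pmf (\<lambda>c. c div 2) (draw C M p) = map_pmf fst (pair_pmf (tentative C M p) (pmf_of_set (UNIV :: bool set)))"
    unfolding draw_def pmf.map_comp by (rule map_pmf_cong) auto
  then show ?thesis by (simp add: map_fst_pair_pmf)
qed

lemma finite_draw: "p \<in># M \<Longrightarrow> finite (set_pmf (draw C M p))"
  by (simp add: draw_def finite_tentative)

section \<open>The algorithm and its runs\<close>

definition profiles :: "gap \<Rightarrow> (nat \<Rightarrow> nat) \<Rightarrow> nat \<Rightarrow> profile list" where
  "profiles I \<pi> l = map (\<lambda>l. item_profile I (\<pi> l)) [1..<Suc l]"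

lemma length_profiles [simp]: "length (profiles I \<pi> l) = l"
  by (simp add: profiles_def)

lemma profiles_nth: "k < l \<Longrightarrow> profiles I \<pi> l ! k = item_profile I (\<pi> (Suc k))"
  by (simp add: profiles_def nth_upt del: upt_Suc)

lemma last_profiles: "l \<ge> 1 \<Longrightarrow> last (profiles I \<pi> l) = item_profile I (\<pi> l)"
  by (simp add: profiles_def)

text \<open>All tentative items after the observation phase count, whether accepted or not. Hence
  the load is unaffected by the coin, and the loads contributed by different rounds are independent
  for a fixed order.\<close>

definition load :: "nat \<Rightarrow> profile list \<Rightarrow> (nat \<Rightarrow> nat) \<Rightarrow> nat \<Rightarrow> real" where
  "load n ps c i = (\<Sum>l\<in>{n div 2<..<length ps}. of_bool (c l div 2 = i) * p_size (ps ! (l - 1)) i)"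

text \<open>An even coin in round 1 keeps the items that still fit on top of the virtual load, an
  odd one keeps the item that crosses the capacity. The test \<open>s \<le> B\<close> lets the
  crossing item fit when it is alone in the bin.\<close>

definition decide :: "nat \<Rightarrow> real list \<Rightarrow> profile list \<Rightarrow> (nat \<Rightarrow> nat) \<Rightarrow> nat option" where
  "decide n C ps c =
     (let i = c (length ps) div 2; s = p_size (last ps) i; u = load n ps c i; B = C ! (i - 1)
      in if n div 2 < length ps \<and> i \<in> {1..length C} \<and> s \<le> B \<and> u < B \<and> (u + s \<le> B \<longleftrightarrow> even (c 1))
         then Some i else None)"

text \<open>Draws of earlier rounds are read from the history, while the current round uses its
  fresh draw; in round 1 this fresh draw is also the coin.\<close>

definition gap_algorithm :: algorithm where
  "gap_algorithm n C ps h =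
     map_pmf (\<lambda>c. (c, decide n C ps (\<lambda>l. if l < length ps then fst (h ! (l - 1)) else c)))
       (draw C (mset ps) (last ps))"

section \<open>Runs driven by independent draws\<close>

lemma decide_cong:
  assumes "\<And>l. 1 \<le> l \<Longrightarrow> l \<le> length ps \<Longrightarrow> c l = c' l" "length ps \<ge> 1"
  shows "decide n C ps c = decide n C ps c'"
proof -
  have "load n ps c i = load n ps c' i" for i
    unfolding load_def by (intro sum.cong refl) (use assms in auto)
  then show ?thesis
    using assms unfolding decide_def by simp
qed

text \<open>The law of a draw depends on the arrivals but not on earlier outcomes. For a fixed order
  the draws therefore form a product distribution, with default 0 outside the rounds.\<close>

definition draws :: "gap \<Rightarrow> (nat \<Rightarrow> nat) \<Rightarrow> nat \<Rightarrow> (nat \<Rightarrow> nat) pmf" where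
  "draws I \<pi> k = Pi_pmf {1..k} 0
     (\<lambda>l. draw (cap_list I) (mset (profiles I \<pi> l)) (item_profile I (\<pi> l)))"

definition decision :: "gap \<Rightarrow> (nat \<Rightarrow> nat) \<Rightarrow> (nat \<Rightarrow> nat) \<Rightarrow> nat \<Rightarrow> nat option" where
  "decision I \<pi> c l = decide (items I) (cap_list I) (profiles I \<pi> l) c"

text \<open>A decision is a function of the draws made so far, so all draws can be made first and
  the decisions computed afterwards.\<close>

lemma run_gap_algorithm:
  "run gap_algorithm I \<pi> k =
     map_pmf (\<lambda>c. map (\<lambda>l. (c l, decision I \<pi> c l)) [1..<Suc k]) (draws I \<pi> k)"
proof (induction k)
  case 0
  then show ?case by (simp add: draws_def)
next
  case (Suc k)
  let ?D = "draw (cap_list I) (mset (profiles I \<pi> (Suc k))) (item_profile I (\<pi> (Suc k)))"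
  let ?h = "\<lambda>c. map (\<lambda>l. (c l, decision I \<pi> c l)) [1..<Suc k]"
  have step: "gap_algorithm (items I) (cap_list I) (profiles I \<pi> (Suc k)) (?h c) =
      map_pmf (\<lambda>d. (d, decision I \<pi> (c(Suc k := d)) (Suc k))) ?D" for c
  proof -
    have "decide (items I) (cap_list I) (profiles I \<pi> (Suc k))
        (\<lambda>l. if l < Suc k then fst (?h c ! (l - 1)) else d) = decision I \<pi> (c(Suc k := d)) (Suc k)" for d
      unfolding decision_def by (rule decide_cong) (auto simp: nth_upt simp del: upt_Suc)
    then show ?thesis
      unfolding gap_algorithm_def by (simp add: last_profiles del: upt_Suc)
  qed
  have "decision I \<pi> (c(Suc k := d)) l = decision I \<pi> c l" if "1 \<le> l" "l < Suc k" for c d l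
    unfolding decision_def by (rule decide_cong) (use that in auto)
  then have h: "map (\<lambda>l. ((c(Suc k := d)) l, decision I \<pi> (c(Suc k := d)) l)) [1..<Suc (Suc k)]
      = ?h c @ [(d, decision I \<pi> (c(Suc k := d)) (Suc k))]" for c d
    using upt_Suc_append[of 1 "Suc k"] by (auto simp del: upt_Suc)
  have "run gap_algorithm I \<pi> (Suc k) =
      bind_pmf (draws I \<pi> k) (\<lambda>c. map_pmf (\<lambda>d. ?h c @ [(d, decision I \<pi> (c(Suc k := d)) (Suc k))]) ?D)"
    unfolding run.simps Suc bind_map_pmf profiles_def[symmetric] step pmf.map_comp o_def ..
  also have "\<dots> = map_pmf (\<lambda>c. map (\<lambda>l. (c l, decision I \<pi> c l)) [1..<Suc (Suc k)])
      (bind_pmf (draws I \<pi> k) (\<lambda>c. map_pmf (\<lambda>d. c(Suc k := d)) ?D))"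
    unfolding map_bind_pmf pmf.map_comp o_def h ..
  also have "bind_pmf (draws I \<pi> k) (\<lambda>c. map_pmf (\<lambda>d. c(Suc k := d)) ?D) = draws I \<pi> (Suc k)"
  proof -
    have "{1..Suc k} = insert (Suc k) {1..k}" by auto
    \<comment> \<open>The insertion rule for products draws the new coordinate first, so the two
      independent draws are exchanged.\<close>
    then show ?thesis
      unfolding draws_def
      by (simp add: Pi_pmf_insert' map_pmf_def del: upt_Suc) (subst bind_commute_pmf, rule refl)
  qed
  finally show ?case .
qed

text \<open>Finite support makes every function of the draws integrable, which justifies linearity
  of expectation later on.\<close>

lemma finite_draws: "finite (set_pmf (draws I \<pi> k))"
proof -
  have "item_profile I (\<pi> l) \<in># mset (profiles I \<pi> l)" if "l \<ge> 1" for l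
    using that by (auto simp: profiles_def)
  then show ?thesis
    unfolding draws_def by (subst set_Pi_pmf) (auto intro!: finite_PiE_dflt finite_draw)
qed

text \<open>Flipping preserves the law of each coordinate but turns the default 0 into
  \<open>flip 0\<close>; the assumption on \<open>f\<close> hides this change outside the
  rounds.\<close>

lemma draws_flip:
  assumes "\<And>c c'. (\<And>l. l \<in> {1..k} \<Longrightarrow> c l = c' l) \<Longrightarrow> f c = f c'"
  shows "measure_pmf.expectation (draws I \<pi> k) (\<lambda>c. f (flip \<circ> c)) =
    measure_pmf.expectation (draws I \<pi> k) (f :: (nat \<Rightarrow> nat) \<Rightarrow> real)"
proof -
  let ?D = "\<lambda>l. draw (cap_list I) (mset (profiles I \<pi> l)) (item_profile I (\<pi> l))"
  have "map_pmf (\<lambda>c. flip \<circ> c) (draws I \<pi> k) = Pi_pmf {1..k} (flip 0) ?D"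
    unfolding draws_def by (subst Pi_pmf_map[symmetric, of _ _ _ "flip 0"]) (simp_all add: flip_draw)
  also have "\<dots> = map_pmf (\<lambda>c l. if l \<in> {1..k} then c l else flip 0) (draws I \<pi> k)"
    unfolding draws_def by (subst Pi_pmf_default_swap) simp_all
  finally have eq: "map_pmf (\<lambda>c. flip \<circ> c) (draws I \<pi> k) = \<dots>" .
  have "measure_pmf.expectation (draws I \<pi> k) (\<lambda>c. f (flip \<circ> c)) =
      measure_pmf.expectation (map_pmf (\<lambda>c. flip \<circ> c) (draws I \<pi> k)) f"
    by simp
  also have "\<dots> = measure_pmf.expectation (draws I \<pi> k) (\<lambda>c. f (\<lambda>l. if l \<in> {1..k} then c l else flip 0))"
    unfolding eq by simp
  also have "\<dots> = measure_pmf.expectation (draws I \<pi> k) f"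
    by (intro Bochner_Integration.integral_cong refl assms) simp
  finally show ?thesis .
qed

lemma draws_component:
  assumes "l \<in> {1..k}"
  shows "measure_pmf.expectation (draws I \<pi> k) (\<lambda>c. of_bool (c l div 2 = i)) =
    pmf (tentative (cap_list I) (mset (profiles I \<pi> l)) (item_profile I (\<pi> l))) i"
proof -
  let ?D = "\<lambda>l. draw (cap_list I) (mset (profiles I \<pi> l)) (item_profile I (\<pi> l))"
  have "measure_pmf.expectation (draws I \<pi> k) (\<lambda>c. of_bool (c l div 2 = i) :: real) =
      measure_pmf.expectation (map_pmf (\<lambda>c. c l) (draws I \<pi> k)) (\<lambda>d. of_bool (d div 2 = i))"
    by (rule integral_map_pmf[symmetric])
  also have "map_pmf (\<lambda>c. c l) (draws I \<pi> k) = ?D l"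
    using assms unfolding draws_def by (subst Pi_pmf_component) auto
  also have "measure_pmf.expectation (?D l) (\<lambda>d. of_bool (d div 2 = i) :: real) =
      measure_pmf.expectation (map_pmf (\<lambda>d. d div 2) (?D l)) (indicator {i})"
    unfolding integral_map_pmf by (intro Bochner_Integration.integral_cong refl) (simp add: indicator_def)
  finally show ?thesis
    by (simp add: draw_div2 measure_pmf_single)
qed

lemma draws_pair:
  assumes "l \<in> {1..k}" "l' \<in> {1..k}" "l \<noteq> l'"
  shows "measure_pmf.expectation (draws I \<pi> k) (\<lambda>c. of_bool (c l div 2 = i) * of_bool (c l' div 2 = i)) =
    measure_pmf.expectation (draws I \<pi> k) (\<lambda>c. of_bool (c l div 2 = i)) *
    measure_pmf.expectation (draws I \<pi> k) (\<lambda>c. of_bool (c l' div 2 = i) :: real)"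
proof -
  let ?D = "\<lambda>l. draw (cap_list I) (mset (profiles I \<pi> l)) (item_profile I (\<pi> l))"
  \<comment> \<open>Factors 1 outside \<open>S\<close> turn an event about the rounds in
    \<open>S\<close> into a product over all rounds. The sets \<open>{l, l'}\<close>,
    \<open>{l}\<close> and \<open>{l'}\<close> then give the independence of two rounds.\<close>
  have E: "measure_pmf.expectation (draws I \<pi> k) (\<lambda>c. \<Prod>j\<in>{1..k}. if j \<in> S then of_bool (c j div 2 = i) else 1) =
     (\<Prod>j\<in>{1..k}. if j \<in> S then measure_pmf.expectation (?D j) (\<lambda>d. of_bool (d div 2 = i)) else (1::real))" for S
  proof -
    have "measure_pmf.expectation (draws I \<pi> k) (\<lambda>c. \<Prod>j\<in>{1..k}. if j \<in> S then of_bool (c j div 2 = i) else 1) =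
     (\<Prod>j\<in>{1..k}. measure_pmf.expectation (?D j) (\<lambda>d. if j \<in> S then of_bool (d div 2 = i) else (1::real)))"
      unfolding draws_def
      by (rule expectation_prod_Pi_pmf[where f = "\<lambda>j d. if j \<in> S then of_bool (d div 2 = i) else 1"])
        (auto intro!: measure_pmf.integrable_const_bound[where B = 1])
    also have "\<dots> = (\<Prod>j\<in>{1..k}. if j \<in> S then measure_pmf.expectation (?D j) (\<lambda>d. of_bool (d div 2 = i)) else (1::real))"
      by (rule prod.cong) auto
    finally show ?thesis .
  qed
  have P: "(\<Prod>j\<in>{1..k}. if j \<in> S then g j else 1) = (\<Prod>j\<in>S. g j)" if "S \<subseteq> {1..k}" for S and g :: "nat \<Rightarrow> real"
    using that by (simp add: prod.inter_restrict[symmetric] Int_absorb1)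
  have E': "measure_pmf.expectation (draws I \<pi> k) (\<lambda>c. \<Prod>j\<in>S. of_bool (c j div 2 = i)) =
     (\<Prod>j\<in>S. measure_pmf.expectation (?D j) (\<lambda>d. of_bool (d div 2 = i) :: real))" if "S \<subseteq> {1..k}" for S
    using E[of S] unfolding P[OF that] .
  show ?thesis
    using E'[of "{l, l'}"] E'[of "{l}"] E'[of "{l'}"] assms by simp
qed

section \<open>Virtual load and acceptance\<close>

definition virtual_load :: "gap \<Rightarrow> (nat \<Rightarrow> nat) \<Rightarrow> (nat \<Rightarrow> nat) \<Rightarrow> nat \<Rightarrow> nat \<Rightarrow> real" where
  "virtual_load I \<pi> c i l =
     (\<Sum>l'\<in>{items I div 2<..<l}. of_bool (c l' div 2 = i) * weight I i (\<pi> l'))"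

lemma decision_eq_Some:
  assumes "i \<in> {1..bins I}" "l \<ge> 1"
  shows "decision I \<pi> c l = Some i \<longleftrightarrow> items I div 2 < l \<and> c l div 2 = i \<and>
    weight I i (\<pi> l) \<le> capacity I i \<and> virtual_load I \<pi> c i l < capacity I i \<and>
    (virtual_load I \<pi> c i l + weight I i (\<pi> l) \<le> capacity I i \<longleftrightarrow> even (c 1))"
proof -
  have load: "load (items I) (profiles I \<pi> l) c i = virtual_load I \<pi> c i l"
    unfolding load_def virtual_load_def using assms
    by (intro sum.cong) (auto simp: profiles_nth)
  have len: "length (cap_list I) = bins I" by simp
  show ?thesis
  proof (cases "c l div 2 = i")
    case True
    show ?thesis
      unfolding decision_def decide_def Let_def length_profiles True last_profiles[OF assms(2)] len
        profile_simps[OF assms(1)] load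
      using assms(1) by (simp split: if_splits)
  next
    case False
    then show ?thesis
      unfolding decision_def decide_def Let_def length_profiles by (simp split: if_splits)
  qed
qed

lemma virtual_load_flip: "virtual_load I \<pi> (flip \<circ> c) i l = virtual_load I \<pi> c i l"
  by (simp add: virtual_load_def)

section \<open>Feasibility of the final assignment\<close>

definition outcomes :: "gap \<Rightarrow> (nat \<Rightarrow> nat) \<Rightarrow> (nat \<Rightarrow> nat) \<Rightarrow> outcome list" where
  "outcomes I \<pi> c = map (\<lambda>l. (c l, decision I \<pi> c l)) [1..<Suc (items I)]"

lemma final_assignment_gap_algorithm:
  "final_assignment gap_algorithm I = bind_pmf (arrival_order (items I)) (\<lambda>\<pi>.
     map_pmf (\<lambda>c. assignment_of I \<pi> (outcomes I \<pi> c)) (draws I \<pi> (items I)))"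
  unfolding final_assignment_def run_gap_algorithm pmf.map_comp o_def outcomes_def ..

lemma assignment_of_outcomes:
  assumes "\<pi> permutes {1..items I}" "l \<in> {1..items I}"
  shows "assignment_of I \<pi> (outcomes I \<pi> c) i (\<pi> l) = of_bool (decision I \<pi> c l = Some i)"
proof -
  have "snd (outcomes I \<pi> c ! (l' - 1)) = decision I \<pi> c l'" if "l' \<in> {1..items I}" for l'
    using that by (auto simp: outcomes_def nth_upt simp del: upt_Suc)
  moreover have "\<pi> l' = \<pi> l \<longleftrightarrow> l' = l" for l'
    using permutes_inj[OF assms(1)] by (auto dest: injD)
  ultimately show ?thesis
    unfolding assignment_of_def using assms(2) by auto
qed

text \<open>For an even coin, look at the last accepted item; for an odd coin, at most one item is
  accepted, because it pushes the virtual load above the capacity.\<close>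

lemma accepted_weight_le_capacity:
  assumes I: "gap_instance I" and \<pi>: "\<pi> permutes {1..items I}" and i: "i \<in> {1..bins I}"
  shows "(\<Sum>l=1..items I. weight I i (\<pi> l) * of_bool (decision I \<pi> c l = Some i)) \<le> capacity I i"
proof -
  let ?n = "items I"
  define S where "S = {l \<in> {1..?n}. decision I \<pi> c l = Some i}"
  have fin: "finite S" by (simp add: S_def)
  have w: "weight I i (\<pi> l) > 0" if "l \<in> {1..?n}" for l
    using I i permutes_in_image[OF \<pi>, of l] that by (simp add: gap_instance_def)
  have S: "?n div 2 < l" "l \<in> {1..?n}" "c l div 2 = i" "weight I i (\<pi> l) \<le> capacity I i"
    "virtual_load I \<pi> c i l < capacity I i"
    "virtual_load I \<pi> c i l + weight I i (\<pi> l) \<le> capacity I i \<longleftrightarrow> even (c 1)" if "l \<in> S" for l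
    using that decision_eq_Some[OF i, of l \<pi> c] by (auto simp: S_def)
  \<comment> \<open>Accepted items were tentative for bin \<open>i\<close>, and weights are
    positive, so those accepted before round \<open>l\<close> weigh no more than the virtual
    load.\<close>
  have le: "(\<Sum>k\<in>T. weight I i (\<pi> k)) \<le> virtual_load I \<pi> c i l"
    if "l \<in> S" "T \<subseteq> S" "\<And>k. k \<in> T \<Longrightarrow> k < l" for l T
  proof -
    have "(\<Sum>k\<in>T. weight I i (\<pi> k)) = (\<Sum>k\<in>T. of_bool (c k div 2 = i) * weight I i (\<pi> k))"
      by (rule sum.cong) (use that S(3) in auto)
    also have "\<dots> \<le> virtual_load I \<pi> c i l"
      unfolding virtual_load_def
    proof (rule sum_mono2)
      show "T \<subseteq> {?n div 2<..<l}" using that S(1) by auto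
      show "0 \<le> of_bool (c k div 2 = i) * weight I i (\<pi> k)" if "k \<in> {?n div 2<..<l} - T" for k
        using w[of k] that S(2)[OF \<open>l \<in> S\<close>] by auto
    qed simp
    finally show ?thesis .
  qed
  have "(\<Sum>l=1..?n. weight I i (\<pi> l) * of_bool (decision I \<pi> c l = Some i)) = (\<Sum>l\<in>S. weight I i (\<pi> l))"
    unfolding S_def by (rule sum.mono_neutral_cong_right) auto
  also have "\<dots> \<le> capacity I i"
  proof (cases "S = {}")
    case True
    then show ?thesis using I i by (simp add: gap_instance_def less_imp_le)
  next
    case False
    define m where "m = Max S"
    have m: "m \<in> S" "\<And>k. k \<in> S \<Longrightarrow> k \<le> m" using fin False by (simp_all add: m_def)
    have split: "(\<Sum>l\<in>S. weight I i (\<pi> l)) = (\<Sum>l\<in>S - {m}. weight I i (\<pi> l)) + weight I i (\<pi> m)"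
      using fin m(1) by (simp add: sum.remove)
    have rest: "(\<Sum>l\<in>S - {m}. weight I i (\<pi> l)) \<le> virtual_load I \<pi> c i m"
    proof (rule le[OF m(1)])
      show "k < m" if "k \<in> S - {m}" for k using m(2)[of k] that by auto
    qed blast
    show ?thesis
    proof (cases "even (c 1)")
      case True
      then show ?thesis using S(6)[OF m(1)] split rest by simp
    next
      case False
      have "S = {m}"
      proof (rule ccontr)
        assume "S \<noteq> {m}"
        then obtain k where "k \<in> S" "k \<noteq> m" using m(1) by blast
        then have k: "k \<in> S" "k < m" using m(2)[of k] by auto
        \<comment> \<open>The virtual load never decreases and from round \<open>k + 1\<close> on
          includes the item of round \<open>k\<close>, which already crossed the capacity. This
          contradicts acceptance in round \<open>m\<close>.\<close>
        have "virtual_load I \<pi> c i k + weight I i (\<pi> k) \<le> virtual_load I \<pi> c i m"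
        proof -
          have "virtual_load I \<pi> c i k + weight I i (\<pi> k) =
              (\<Sum>l\<in>insert k {?n div 2<..<k}. of_bool (c l div 2 = i) * weight I i (\<pi> l))"
            using S(3)[OF k(1)] by (simp add: virtual_load_def)
          also have "\<dots> \<le> virtual_load I \<pi> c i m"
            unfolding virtual_load_def
          proof (rule sum_mono2)
            show "insert k {?n div 2<..<k} \<subseteq> {?n div 2<..<m}" using k S(1) by auto
            show "0 \<le> of_bool (c j div 2 = i) * weight I i (\<pi> j)"
              if "j \<in> {?n div 2<..<m} - insert k {?n div 2<..<k}" for j
              using w[of j] that S(2)[OF m(1)] by auto
          qed simp
          finally show ?thesis .
        qed
        then show False
          using S(5)[OF m(1)] S(6)[OF k(1)] False by simp
      qed
      then show ?thesis using S(4)[OF m(1)] by simp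
    qed
  qed
  finally show ?thesis .
qed

lemma feasible_assignment_of_outcomes:
  assumes I: "gap_instance I" and \<pi>: "\<pi> permutes {1..items I}"
  shows "feasible I (assignment_of I \<pi> (outcomes I \<pi> c))"
  unfolding feasible_def
proof (intro conjI ballI)
  let ?x = "assignment_of I \<pi> (outcomes I \<pi> c)"
  show "?x i j \<in> {0, 1}" for i j
    by (simp add: assignment_of_def)
  show "(\<Sum>j=1..items I. weight I i j * ?x i j) \<le> capacity I i" if "i \<in> {1..bins I}" for i
  proof -
    have "(\<Sum>j=1..items I. weight I i j * ?x i j) = (\<Sum>l=1..items I. weight I i (\<pi> l) * ?x i (\<pi> l))"
      by (subst sum.permute[OF \<pi>]) simp
    also have "\<dots> = (\<Sum>l=1..items I. weight I i (\<pi> l) * of_bool (decision I \<pi> c l = Some i))"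
      by (rule sum.cong) (simp_all add: assignment_of_outcomes[OF \<pi>])
    finally show ?thesis using accepted_weight_le_capacity[OF I \<pi> that] by simp
  qed
  show "(\<Sum>i=1..bins I. ?x i j) \<le> 1" if "j \<in> {1..items I}" for j
  proof -
    have "j \<in> \<pi> ` {1..items I}"
      unfolding permutes_image[OF \<pi>] by (rule that)
    then obtain l where l: "l \<in> {1..items I}" "\<pi> l = j" by blast
    have "(\<Sum>i=1..bins I. ?x i j) = (\<Sum>i=1..bins I. of_bool (decision I \<pi> c l = Some i))"
      unfolding l(2)[symmetric] assignment_of_outcomes[OF \<pi> l(1)] ..
    also have "\<dots> \<le> 1"
    proof (cases "decision I \<pi> c l")
      case (Some k)
      then have "(\<Sum>i=1..bins I. of_bool (decision I \<pi> c l = Some i)) = (\<Sum>i=1..bins I. if k = i then 1 else 0 :: real)"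
        by (intro sum.cong) auto
      then show ?thesis by simp
    qed simp
    finally show ?thesis .
  qed
qed

lemma set_arrival_order: "set_pmf (arrival_order n) = {\<pi>. \<pi> permutes {1..n}}"
proof -
  have "{\<pi>. \<pi> permutes {1..n}} \<noteq> {}" using permutes_id[of "{1..n}"] by blast
  then show ?thesis
    unfolding arrival_order_def by (intro set_pmf_of_set) (simp_all add: finite_permutations)
qed

lemma always_feasible_gap_algorithm: "always_feasible gap_algorithm"
  unfolding always_feasible_def final_assignment_gap_algorithm
  by (auto simp: set_arrival_order intro!: feasible_assignment_of_outcomes)

section \<open>The value collected for a fixed arrival order\<close>

definition run_value :: "gap \<Rightarrow> (nat \<Rightarrow> nat) \<Rightarrow> (nat \<Rightarrow> nat) \<Rightarrow> real" where
  "run_value I \<pi> c =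
     (\<Sum>i=1..bins I. \<Sum>l=1..items I. worth I i (\<pi> l) * of_bool (decision I \<pi> c l = Some i))"

lemma assignment_value_outcomes:
  assumes \<pi>: "\<pi> permutes {1..items I}"
  shows "assignment_value I (assignment_of I \<pi> (outcomes I \<pi> c)) = run_value I \<pi> c"
  unfolding assignment_value_def run_value_def
proof (rule sum.cong[OF refl])
  fix i
  let ?x = "assignment_of I \<pi> (outcomes I \<pi> c)"
  have "(\<Sum>j=1..items I. worth I i j * ?x i j) = (\<Sum>l=1..items I. worth I i (\<pi> l) * ?x i (\<pi> l))"
    by (subst sum.permute[OF \<pi>]) simp
  also have "\<dots> = (\<Sum>l=1..items I. worth I i (\<pi> l) * of_bool (decision I \<pi> c l = Some i))"
    by (rule sum.cong) (simp_all add: assignment_of_outcomes[OF \<pi>])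
  finally show "(\<Sum>j=1..items I. worth I i j * ?x i j) = \<dots>" .
qed

lemma expectation_final_assignment:
  "measure_pmf.expectation (final_assignment gap_algorithm I) (assignment_value I) =
     (\<Sum>\<pi> | \<pi> permutes {1..items I}. measure_pmf.expectation (draws I \<pi> (items I)) (run_value I \<pi>))
       / fact (items I)"
proof -
  let ?P = "{\<pi>. \<pi> permutes {1..items I}}"
  have "id \<in> ?P" by (simp add: permutes_id)
  then have P: "?P \<noteq> {}" "finite ?P" "card ?P = fact (items I)"
    by (blast, simp_all add: finite_permutations card_permutations del: One_nat_def)
  have "measure_pmf.expectation (final_assignment gap_algorithm I) (assignment_value I) =
    (\<Sum>\<pi>\<in>?P. pmf (arrival_order (items I)) \<pi> *\<^sub>R measure_pmf.expectation
       (map_pmf (\<lambda>c. assignment_of I \<pi> (outcomes I \<pi> c)) (draws I \<pi> (items I))) (assignment_value I))"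
    unfolding final_assignment_gap_algorithm
    by (rule pmf_expectation_bind) (simp_all add: P set_arrival_order finite_draws del: One_nat_def)
  also have "\<dots> = (\<Sum>\<pi>\<in>?P. measure_pmf.expectation (draws I \<pi> (items I)) (run_value I \<pi>) / fact (items I))"
  proof (rule sum.cong[OF refl])
    fix \<pi> assume "\<pi> \<in> ?P"
    then show "pmf (arrival_order (items I)) \<pi> *\<^sub>R measure_pmf.expectation
       (map_pmf (\<lambda>c. assignment_of I \<pi> (outcomes I \<pi> c)) (draws I \<pi> (items I))) (assignment_value I)
      = measure_pmf.expectation (draws I \<pi> (items I)) (run_value I \<pi>) / fact (items I)"
      using P by (simp add: arrival_order_def assignment_value_outcomes del: One_nat_def)
  qed
  finally show ?thesis by (simp add: sum_divide_distrib)
qed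

text \<open>Items larger than the capacity are never packed, so they may be given value 0.\<close>

definition fitting_worth :: "gap \<Rightarrow> nat \<Rightarrow> nat \<Rightarrow> real" where
  "fitting_worth I i j = worth I i j * of_bool (weight I i j \<le> capacity I i)"

text \<open>The two coins together collect every tentative item that finds the virtual load below the
  capacity; the indicator of this event is at least one minus the relative load.\<close>

lemma run_value_flip_ge:
  assumes I: "gap_instance I" and \<pi>: "\<pi> permutes {1..items I}"
  shows "(\<Sum>i=1..bins I. \<Sum>l\<in>{items I div 2<..items I}. fitting_worth I i (\<pi> l) * of_bool (c l div 2 = i) *
      (1 - virtual_load I \<pi> c i l / capacity I i)) \<le> run_value I \<pi> c + run_value I \<pi> (flip \<circ> c)"
proof -
  have "(\<Sum>l\<in>{items I div 2<..items I}. fitting_worth I i (\<pi> l) * of_bool (c l div 2 = i) *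
      (1 - virtual_load I \<pi> c i l / capacity I i)) \<le>
    (\<Sum>l=1..items I. worth I i (\<pi> l) * of_bool (decision I \<pi> c l = Some i) +
      worth I i (\<pi> l) * of_bool (decision I \<pi> (flip \<circ> c) l = Some i))"
    (is "?lhs \<le> _") if i: "i \<in> {1..bins I}" for i
  proof -
    have cap: "capacity I i > 0" using I i by (simp add: gap_instance_def)
    have pos: "worth I i (\<pi> l) > 0" "weight I i (\<pi> l) > 0" if "l \<in> {1..items I}" for l
      using I i permutes_in_image[OF \<pi>, of l] that by (simp_all add: gap_instance_def)
    have "?lhs \<le> (\<Sum>l\<in>{items I div 2<..items I}. worth I i (\<pi> l) * of_bool (decision I \<pi> c l = Some i) +
      worth I i (\<pi> l) * of_bool (decision I \<pi> (flip \<circ> c) l = Some i))"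
    proof (rule sum_mono)
      fix l assume l: "l \<in> {items I div 2<..items I}"
      then have l': "l \<in> {1..items I}" by auto
      note w = pos[OF l']
      have v0: "virtual_load I \<pi> c i l \<ge> 0"
        unfolding virtual_load_def using l by (intro sum_nonneg mult_nonneg_nonneg) (auto intro!: less_imp_le[OF pos(2)])
      show "fitting_worth I i (\<pi> l) * of_bool (c l div 2 = i) * (1 - virtual_load I \<pi> c i l / capacity I i)
        \<le> worth I i (\<pi> l) * of_bool (decision I \<pi> c l = Some i) +
          worth I i (\<pi> l) * of_bool (decision I \<pi> (flip \<circ> c) l = Some i)"
      proof (cases "weight I i (\<pi> l) \<le> capacity I i \<and> c l div 2 = i \<and> virtual_load I \<pi> c i l < capacity I i")
        case True
        have "worth I i (\<pi> l) * (1 - virtual_load I \<pi> c i l / capacity I i) \<le> worth I i (\<pi> l) * 1"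
          using w cap v0 by (intro mult_left_mono) simp_all
        \<comment> \<open>The flip reverses the parity of \<open>c 1\<close> and leaves bins and
          virtual load alone, so exactly one of the two coins accepts.\<close>
        moreover have "of_bool (decision I \<pi> c l = Some i) + of_bool (decision I \<pi> (flip \<circ> c) l = Some i) = (1 :: real)"
          using True l l' i by (simp add: decision_eq_Some virtual_load_flip)
        ultimately show ?thesis
          using True by (simp add: fitting_worth_def distrib_left[symmetric])
      next
        case False
        \<comment> \<open>Either one of the indicators vanishes, or the virtual load has reached the
          capacity and the last factor is at most 0.\<close>
        then have "fitting_worth I i (\<pi> l) * of_bool (c l div 2 = i) * (1 - virtual_load I \<pi> c i l / capacity I i) \<le> 0"
          using w cap by (auto simp: fitting_worth_def mult_le_0_iff not_less)
        also have "0 \<le> worth I i (\<pi> l) * of_bool (decision I \<pi> c l = Some i) +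
          worth I i (\<pi> l) * of_bool (decision I \<pi> (flip \<circ> c) l = Some i)"
          using w by simp
        finally show ?thesis .
      qed
    qed
    also have "\<dots> \<le> (\<Sum>l=1..items I. worth I i (\<pi> l) * of_bool (decision I \<pi> c l = Some i) +
      worth I i (\<pi> l) * of_bool (decision I \<pi> (flip \<circ> c) l = Some i))"
      using pos(1) by (intro sum_mono2) (auto simp: less_imp_le)
    finally show ?thesis .
  qed
  then show ?thesis
    unfolding run_value_def sum.distrib[symmetric] by (rule sum_mono)
qed

text \<open>Depends on \<open>\<pi>\<close> only through the multiset of the first \<open>l\<close>
  profiles and the profile of round \<open>l\<close>; the exchange arguments rest on this.\<close>

definition tentative_prob :: "gap \<Rightarrow> (nat \<Rightarrow> nat) \<Rightarrow> nat \<Rightarrow> nat \<Rightarrow> real" where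
  "tentative_prob I \<pi> i l =
     pmf (tentative (cap_list I) (mset (profiles I \<pi> l)) (item_profile I (\<pi> l))) i"

text \<open>Expectations are taken in \<open>run_value_flip_ge\<close>. Independence of the rounds
  factors each product of two bin indicators, and flip invariance merges the two coins into the
  factor 2.\<close>

lemma expectation_run_value_ge:
  assumes I: "gap_instance I" and \<pi>: "\<pi> permutes {1..items I}"
  shows "(\<Sum>i=1..bins I. \<Sum>l\<in>{items I div 2<..items I}. fitting_worth I i (\<pi> l) * tentative_prob I \<pi> i l *
      (1 - (\<Sum>l'\<in>{items I div 2<..<l}. tentative_prob I \<pi> i l' * weight I i (\<pi> l') / capacity I i)))
    \<le> 2 * measure_pmf.expectation (draws I \<pi> (items I)) (run_value I \<pi>)" (is "?lhs \<le> _")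
proof -
  let ?n = "items I"
  let ?E = "measure_pmf.expectation (draws I \<pi> ?n) :: _ \<Rightarrow> real"
  note int = integrable_measure_pmf_finite[OF finite_draws[of I \<pi> ?n]]
  have one: "?E (\<lambda>c. of_bool (c l div 2 = i)) = tentative_prob I \<pi> i l" if "l \<in> {1..?n}" for i l
    unfolding tentative_prob_def by (rule draws_component[OF that])
  \<comment> \<open>Links the bound with the virtual load to its expansion into indicators of one or
    two rounds, whose expectations are known.\<close>
  have factor: "F * (b - (\<Sum>l'\<in>A. w l' / B * (b * b' l'))) = F * b * (1 - (\<Sum>l'\<in>A. b' l' * w l') / B)"
    for F b B :: real and b' w :: "nat \<Rightarrow> real" and A
  proof -
    have "(\<Sum>l'\<in>A. w l' / B * (b * b' l')) = b * ((\<Sum>l'\<in>A. b' l' * w l') / B)"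
      unfolding sum_divide_distrib sum_distrib_left by (rule sum.cong) simp_all
    then show ?thesis by (metis mult.assoc mult.right_neutral right_diff_distrib)
  qed
  have dec: "decision I \<pi> c l = decision I \<pi> c' l"
    if "l \<in> {1..?n}" "\<And>l. l \<in> {1..?n} \<Longrightarrow> c l = c' l" for c c' l
    unfolding decision_def by (rule decide_cong) (use that in auto)
  have "?lhs = (\<Sum>i=1..bins I. \<Sum>l\<in>{?n div 2<..?n}. fitting_worth I i (\<pi> l) *
     (?E (\<lambda>c. of_bool (c l div 2 = i)) - (\<Sum>l'\<in>{?n div 2<..<l}. weight I i (\<pi> l') / capacity I i *
         ?E (\<lambda>c. of_bool (c l div 2 = i) * of_bool (c l' div 2 = i)))))"
  proof (intro sum.cong refl)
    fix i l assume l: "l \<in> {?n div 2<..?n}"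
    then have l1: "l \<in> {1..?n}" by auto
    have eq: "(\<Sum>l'\<in>{?n div 2<..<l}. weight I i (\<pi> l') / capacity I i *
         ?E (\<lambda>c. of_bool (c l div 2 = i) * of_bool (c l' div 2 = i))) =
      tentative_prob I \<pi> i l * (\<Sum>l'\<in>{?n div 2<..<l}. tentative_prob I \<pi> i l' * weight I i (\<pi> l') / capacity I i)"
      unfolding sum_distrib_left
    proof (rule sum.cong[OF refl])
      fix l' assume "l' \<in> {?n div 2<..<l}"
      then have l': "l' \<in> {1..?n}" "l \<noteq> l'" using l by auto
      show "weight I i (\<pi> l') / capacity I i * ?E (\<lambda>c. of_bool (c l div 2 = i) * of_bool (c l' div 2 = i)) =
        tentative_prob I \<pi> i l * (tentative_prob I \<pi> i l' * weight I i (\<pi> l') / capacity I i)"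
        using draws_pair[OF l1 l', of I \<pi> i] one[OF l1, of i] one[OF l'(1), of i] by simp
    qed
    show "fitting_worth I i (\<pi> l) * tentative_prob I \<pi> i l *
      (1 - (\<Sum>l'\<in>{?n div 2<..<l}. tentative_prob I \<pi> i l' * weight I i (\<pi> l') / capacity I i)) =
      fitting_worth I i (\<pi> l) *
     (?E (\<lambda>c. of_bool (c l div 2 = i)) - (\<Sum>l'\<in>{?n div 2<..<l}. weight I i (\<pi> l') / capacity I i *
         ?E (\<lambda>c. of_bool (c l div 2 = i) * of_bool (c l' div 2 = i))))"
      unfolding eq one[OF l1] by (simp only: right_diff_distrib mult_1_right mult.assoc)
  qed
  also have "\<dots> = ?E (\<lambda>c. \<Sum>i=1..bins I. \<Sum>l\<in>{?n div 2<..?n}. fitting_worth I i (\<pi> l) *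
     (of_bool (c l div 2 = i) - (\<Sum>l'\<in>{?n div 2<..<l}. weight I i (\<pi> l') / capacity I i *
         (of_bool (c l div 2 = i) * of_bool (c l' div 2 = i)))))"
    by (simp only: Bochner_Integration.integral_sum[OF int] Bochner_Integration.integral_diff[OF int int]
        integral_mult_right_zero)
  also have "\<dots> = ?E (\<lambda>c. \<Sum>i=1..bins I. \<Sum>l\<in>{?n div 2<..?n}. fitting_worth I i (\<pi> l) * of_bool (c l div 2 = i) *
      (1 - virtual_load I \<pi> c i l / capacity I i))"
    by (simp only: virtual_load_def factor)
  also have "\<dots> \<le> ?E (\<lambda>c. run_value I \<pi> c + run_value I \<pi> (flip \<circ> c))"
    by (intro integral_mono int run_value_flip_ge assms)
  also have "\<dots> = ?E (run_value I \<pi>) + ?E (\<lambda>c. run_value I \<pi> (flip \<circ> c))"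
    by (intro Bochner_Integration.integral_add int)
  also have "?E (\<lambda>c. run_value I \<pi> (flip \<circ> c)) = ?E (run_value I \<pi>)"
  proof (rule draws_flip)
    fix c c' :: "nat \<Rightarrow> nat" assume "\<And>l. l \<in> {1..?n} \<Longrightarrow> c l = c' l"
    from dec[OF _ this] show "run_value I \<pi> c = run_value I \<pi> c'"
      unfolding run_value_def by (intro sum.cong refl) simp
  qed
  finally show ?thesis by simp
qed

section \<open>Averaging over the arrival order\<close>

text \<open>Swapping positions \<open>a\<close> and \<open>l\<close> is a bijection on the orders.
  This replaces conditioning: with the first \<open>l\<close> items fixed as a set, each of them is
  equally likely to arrive in round \<open>l\<close>.\<close>

lemma sum_permutes_average:
  fixes f :: "(nat \<Rightarrow> nat) \<Rightarrow> real"
  assumes "l \<in> {1..n}"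
  shows "(\<Sum>\<pi> | \<pi> permutes {1..n}. f \<pi>) =
    (\<Sum>\<pi> | \<pi> permutes {1..n}. \<Sum>a=1..l. f (\<pi> \<circ> Transposition.transpose a l)) / l"
proof -
  have "(\<Sum>\<pi> | \<pi> permutes {1..n}. f (\<pi> \<circ> Transposition.transpose a l)) = (\<Sum>\<pi> | \<pi> permutes {1..n}. f \<pi>)"
    if "a \<in> {1..l}" for a
    by (rule sum_permutations_compose_right[symmetric]) (rule permutes_swap_id; use that assms in auto)
  then have "(\<Sum>a=1..l. \<Sum>\<pi> | \<pi> permutes {1..n}. f (\<pi> \<circ> Transposition.transpose a l)) =
      l * (\<Sum>\<pi> | \<pi> permutes {1..n}. f \<pi>)"
    by simp
  then show ?thesis
    using assms by (subst sum.swap) simp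
qed

lemma sum_permutes_apply:
  fixes g :: "nat \<Rightarrow> real"
  assumes "a \<in> {1..n}"
  shows "(\<Sum>\<pi> | \<pi> permutes {1..n}. g (\<pi> a)) = fact n * (\<Sum>j=1..n. g j) / n"
proof -
  \<comment> \<open>Position \<open>a\<close> is moved to \<open>n\<close>, so that averaging over
    all \<open>n\<close> positions runs through all items.\<close>
  have "(\<Sum>\<pi> | \<pi> permutes {1..n}. g (\<pi> a)) = (\<Sum>\<pi> | \<pi> permutes {1..n}. g ((\<pi> \<circ> Transposition.transpose a n) a))"
    by (rule sum_permutations_compose_right) (rule permutes_swap_id; use assms in auto)
  also have "\<dots> = (\<Sum>\<pi> | \<pi> permutes {1..n}. g (\<pi> n))" by simp
  also have "\<dots> = (\<Sum>\<pi> | \<pi> permutes {1..n}. \<Sum>b=1..n. g ((\<pi> \<circ> Transposition.transpose b n) n)) / n"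
    using assms by (intro sum_permutes_average) auto
  also have "\<dots> = (\<Sum>\<pi> | \<pi> permutes {1..n}. \<Sum>j=1..n. g j) / n"
  proof (rule arg_cong2[where f = "(/)"], rule sum.cong[OF refl])
    fix \<pi> assume "\<pi> \<in> {\<pi>. \<pi> permutes {1..n}}"
    then have "\<pi> permutes {1..n}" by simp
    from sum.permute[OF this, of g]
    show "(\<Sum>b=1..n. g ((\<pi> \<circ> Transposition.transpose b n) n)) = (\<Sum>j=1..n. g j)"
      by (simp add: o_def)
  qed simp
  also have "\<dots> = fact n * (\<Sum>j=1..n. g j) / n"
    by (simp add: card_permutations[OF refl])
  finally show ?thesis .
qed

section \<open>Invariance under rearranging the first arrivals\<close>

lemma mset_profiles: "mset (profiles I \<pi> l) = image_mset (\<lambda>a. item_profile I (\<pi> a)) (mset_set {1..l})"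
proof -
  have "{1..<Suc l} = {1..l}" by auto
  then show ?thesis by (simp add: profiles_def del: upt_Suc)
qed

lemma mset_profiles_permute:
  assumes "\<tau> permutes {1..l}"
  shows "mset (profiles I (\<pi> \<circ> \<tau>) l) = mset (profiles I \<pi> l)"
proof -
  have "image_mset (\<lambda>a. item_profile I (\<pi> (\<tau> a))) (mset_set {1..l}) =
      image_mset (\<lambda>a. item_profile I (\<pi> a)) (image_mset \<tau> (mset_set {1..l}))"
    by (simp add: image_mset.compositionality o_def)
  also have "image_mset \<tau> (mset_set {1..l}) = mset_set {1..l}"
    using image_mset_mset_set[OF permutes_inj_on[OF assms]] permutes_image[OF assms] by metis
  finally show ?thesis by (simp add: mset_profiles)
qed

lemma transpose_permutes: "a \<in> {1..l} \<Longrightarrow> l \<le> k \<Longrightarrow> Transposition.transpose a l permutes {1..(k :: nat)}"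
  by (rule permutes_swap_id) auto

text \<open>As \<open>l' < l\<close>, the transposition rearranges the first \<open>l\<close>
  arrivals and fixes round \<open>l\<close>, so the multiset and the current profile stay the
  same.\<close>

lemma tentative_prob_transpose_later:
  assumes "a \<in> {1..l'}" "l' < l"
  shows "tentative_prob I (\<pi> \<circ> Transposition.transpose a l') i l = tentative_prob I \<pi> i l"
    and "(\<pi> \<circ> Transposition.transpose a l') l = \<pi> l"
proof -
  have "Transposition.transpose a l' permutes {1..l}"
    using assms by (intro transpose_permutes) auto
  from mset_profiles_permute[OF this]
  show "tentative_prob I (\<pi> \<circ> Transposition.transpose a l') i l = tentative_prob I \<pi> i l"
    using assms by (simp add: tentative_prob_def transpose_apply_other)
  show "(\<pi> \<circ> Transposition.transpose a l') l = \<pi> l"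
    using assms by (simp add: transpose_apply_other)
qed

section \<open>Mean size and value of the tentative item of a round\<close>

abbreviation packed :: "gap \<Rightarrow> (nat \<Rightarrow> nat) \<Rightarrow> nat \<Rightarrow> profile list" where
  "packed I \<pi> l \<equiv> canonical (mset (profiles I \<pi> l))"

text \<open>Each transposition makes another of the first \<open>l\<close> items the current one
  while the multiset stays, which is the situation of \<open>sum_tentative\<close>.\<close>

lemma sum_tentative_prob:
  fixes g :: "profile \<Rightarrow> real"
  shows "(\<Sum>a=1..l. tentative_prob I (\<pi> \<circ> Transposition.transpose a l) i l * g (item_profile I (\<pi> a))) =
    (\<Sum>k | k < l \<and> best_packing (cap_list I) (packed I \<pi> l) k = i. g (packed I \<pi> l ! k))"
proof -
  let ?M = "mset (profiles I \<pi> l)"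
  have "(\<Sum>a=1..l. tentative_prob I (\<pi> \<circ> Transposition.transpose a l) i l * g (item_profile I (\<pi> a))) =
      (\<Sum>a=1..l. pmf (tentative (cap_list I) ?M (item_profile I (\<pi> a))) i * g (item_profile I (\<pi> a)))"
  proof (rule sum.cong[OF refl])
    fix a assume "a \<in> {1..l}"
    from mset_profiles_permute[OF transpose_permutes[OF this order_refl]]
    show "tentative_prob I (\<pi> \<circ> Transposition.transpose a l) i l * g (item_profile I (\<pi> a)) =
        pmf (tentative (cap_list I) ?M (item_profile I (\<pi> a))) i * g (item_profile I (\<pi> a))"
      by (simp add: tentative_prob_def del: upt_Suc)
  qed
  also have "\<dots> = (\<Sum>p\<in>#?M. pmf (tentative (cap_list I) ?M p) i * g p)"
    unfolding sum_unfold_sum_mset mset_profiles by (simp add: image_mset.compositionality o_def)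
  also have "\<dots> = (\<Sum>k | k < size ?M \<and> best_packing (cap_list I) (packed I \<pi> l) k = i. g (packed I \<pi> l ! k))"
    by (rule sum_tentative)
  finally show ?thesis by (simp del: upt_Suc)
qed

lemma best_packing_capacity:
  assumes "gap_instance I" "i \<in> {1..bins I}"
  shows "(\<Sum>k | k < l \<and> best_packing (cap_list I) (packed I \<pi> l) k = i. p_size (packed I \<pi> l ! k) i)
    \<le> capacity I i"
proof -
  have "best_packing (cap_list I) (packed I \<pi> l) \<in> packings (cap_list I) (packed I \<pi> l)"
    using assms by (intro best_packing(1)) (auto simp: gap_instance_def less_imp_le nth_upt simp del: upt_Suc)
  then have "\<forall>i\<in>{1..bins I}. (\<Sum>k | k < l \<and> best_packing (cap_list I) (packed I \<pi> l) k = i.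
      p_size (packed I \<pi> l ! k) i) \<le> cap_list I ! (i - 1)"
    by (simp add: packings_def del: upt_Suc)
  with assms(2) have "(\<Sum>k | k < l \<and> best_packing (cap_list I) (packed I \<pi> l) k = i.
      p_size (packed I \<pi> l ! k) i) \<le> cap_list I ! (i - 1)" by blast
  then show ?thesis unfolding profile_simps(3)[OF assms(2)] .
qed

text \<open>Divided by \<open>l\<close>, this bounds the expected size that round \<open>l\<close>
  brings to bin \<open>i\<close> by \<open>capacity I i / l\<close>, given the set of the first
  \<open>l\<close> items.\<close>

lemma sum_tentative_weight_le:
  assumes "gap_instance I" "i \<in> {1..bins I}"
  shows "(\<Sum>a=1..l. tentative_prob I (\<pi> \<circ> Transposition.transpose a l) i l * weight I i (\<pi> a)) \<le> capacity I i"
  using sum_tentative_prob[where I = I and \<pi> = \<pi> and l = l and i = i and g = "\<lambda>p. p_size p i"] best_packing_capacity[OF assms, where l = l and \<pi> = \<pi>]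
  by (simp only: profile_simps(2)[OF assms(2)])

text \<open>Sizes are positive, so each item in a packed bin is at most as large as the whole load
  and fits by itself. Restricting to fitting items thus loses none of the packing's value.\<close>

lemma sum_fitting_worth_eq:
  assumes I: "gap_instance I" and \<pi>: "\<pi> permutes {1..items I}" and l: "l \<le> items I"
    and i: "i \<in> {1..bins I}"
  shows "(\<Sum>a=1..l. tentative_prob I (\<pi> \<circ> Transposition.transpose a l) i l * fitting_worth I i (\<pi> a)) =
    (\<Sum>k | k < l \<and> best_packing (cap_list I) (packed I \<pi> l) k = i. p_value (packed I \<pi> l ! k) i)"
    (is "_ = sum _ ?K")
proof -
  let ?g = "\<lambda>p. p_value p i * of_bool (p_size p i \<le> capacity I i)"
  have pos: "p_size (packed I \<pi> l ! k) i > 0" if "k < l" for k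
  proof -
    have "packed I \<pi> l ! k \<in> set (packed I \<pi> l)" using that by simp
    also have "set (packed I \<pi> l) = set_mset (mset (profiles I \<pi> l))"
      by (metis mset_canonical set_mset_mset)
    finally obtain a where "a \<in> {1..l}" "packed I \<pi> l ! k = item_profile I (\<pi> a)"
      by (auto simp: mset_profiles)
    then show ?thesis
      using I i l permutes_in_image[OF \<pi>, of a] by (simp add: gap_instance_def del: One_nat_def)
  qed
  have "(\<Sum>a=1..l. tentative_prob I (\<pi> \<circ> Transposition.transpose a l) i l * fitting_worth I i (\<pi> a)) = sum (\<lambda>k. ?g (packed I \<pi> l ! k)) ?K"
    using sum_tentative_prob[where I = I and \<pi> = \<pi> and l = l and i = i and g = ?g] by (simp only: profile_simps[OF i] fitting_worth_def)
  also have "\<dots> = sum (\<lambda>k. p_value (packed I \<pi> l ! k) i) ?K"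
  proof (rule sum.cong[OF refl])
    fix k assume k: "k \<in> ?K"
    have "p_size (packed I \<pi> l ! k) i \<le> (\<Sum>k\<in>?K. p_size (packed I \<pi> l ! k) i)"
    proof (rule member_le_sum[OF k])
      show "0 \<le> p_size (packed I \<pi> l ! k') i" if "k' \<in> ?K - {k}" for k'
        using pos[of k'] that by (simp del: upt_Suc)
    qed simp
    also have "\<dots> \<le> capacity I i" by (rule best_packing_capacity[OF I i])
    finally show "?g (packed I \<pi> l ! k) = p_value (packed I \<pi> l ! k) i" by simp
  qed
  finally show ?thesis .
qed

text \<open>The packing found in round \<open>l\<close> is compared with the restriction of \<open>x\<close> to the first \<open>l\<close> items.\<close>

lemma sum_tentative_worth_ge:
  assumes I: "gap_instance I" and \<pi>: "\<pi> permutes {1..items I}" and l: "l \<le> items I"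
    and x: "feasible I x"
  shows "(\<Sum>a=1..l. \<Sum>i=1..bins I. worth I i (\<pi> a) * x i (\<pi> a)) \<le>
    (\<Sum>i=1..bins I. \<Sum>a=1..l. tentative_prob I (\<pi> \<circ> Transposition.transpose a l) i l * fitting_worth I i (\<pi> a))"
proof -
  \<comment> \<open>Decodes \<open>x\<close> into the form used by \<open>packings\<close>, with 0
    for unassigned items.\<close>
  define \<beta> where "\<beta> j = (if \<exists>i\<in>{1..bins I}. x i j = 1 then SOME i. i \<in> {1..bins I} \<and> x i j = 1 else 0)" for j
  have \<beta>_some: "\<beta> j \<in> {1..bins I} \<and> x (\<beta> j) j = 1" if "\<exists>i\<in>{1..bins I}. x i j = 1" for j
  proof -
    have some: "\<beta> j = (SOME i. i \<in> {1..bins I} \<and> x i j = 1)"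
      unfolding \<beta>_def using that by (rule if_P)
    have "\<exists>i. i \<in> {1..bins I} \<and> x i j = 1" using that by blast
    from someI_ex[OF this] show ?thesis unfolding some .
  qed
  have \<beta>_none: "\<beta> j = 0" if "\<not> (\<exists>i\<in>{1..bins I}. x i j = 1)" for j
    unfolding \<beta>_def using that by (rule if_not_P)
  have \<beta>_le: "\<beta> j \<le> bins I" for j
  proof (cases "\<exists>i\<in>{1..bins I}. x i j = 1")
    case True
    from \<beta>_some[OF this] show ?thesis by simp
  next
    case False
    from \<beta>_none[OF this] show ?thesis by simp
  qed
  have x01: "x i j \<in> {0, 1}" if "i \<in> {1..bins I}" "j \<in> {1..items I}" for i j
    using x that by (simp add: feasible_def)
  have \<beta>: "x i j = of_bool (\<beta> j = i)" if i: "i \<in> {1..bins I}" and j: "j \<in> {1..items I}" for i j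
  proof (cases "\<exists>i\<in>{1..bins I}. x i j = 1")
    case True
    then have b: "\<beta> j \<in> {1..bins I}" "x (\<beta> j) j = 1" using \<beta>_some[of j] by blast+
    show ?thesis
    proof (cases "\<beta> j = i")
      case False
      \<comment> \<open>A second bin holding \<open>j\<close> would raise the total over all bins to
        at least 2.\<close>
      have "x i j + x (\<beta> j) j = (\<Sum>i\<in>{i, \<beta> j}. x i j)" using False by simp
      also have "\<dots> \<le> (\<Sum>i=1..bins I. x i j)"
      proof (rule sum_mono2)
        show "0 \<le> x k j" if "k \<in> {1..bins I} - {i, \<beta> j}" for k
          using x01[of k j] that j by auto
      qed (use i b in auto)
      also have "\<dots> \<le> 1" using x j by (simp add: feasible_def)
      finally have "x i j \<noteq> 1" using b(2) by linarith
      then show ?thesis using x01[OF i j] False by simp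
    qed (use b in auto)
  next
    case False
    then have "x i j \<noteq> 1" using i by blast
    then show ?thesis using \<beta>_none[OF False] x01[OF i j] i by simp
  qed
  have \<pi>_in: "\<pi> a \<in> {1..items I} \<longleftrightarrow> a \<in> {1..items I}" for a
    using permutes_in_image[OF \<pi>] .
  let ?ps = "profiles I \<pi> l" and ?b = "\<lambda>k. \<beta> (\<pi> (Suc k))"
  have sums: "(\<Sum>k | k < length ?ps \<and> ?b k = i. g (?ps ! k)) = (\<Sum>a=1..l. g (item_profile I (\<pi> a)) * x i (\<pi> a))"
    if i: "i \<in> {1..bins I}" for i and g :: "profile \<Rightarrow> real"
  proof -
    have "(\<Sum>k | k < length ?ps \<and> ?b k = i. g (?ps ! k)) =
        (\<Sum>k<l. g (item_profile I (\<pi> (Suc k))) * of_bool (\<beta> (\<pi> (Suc k)) = i))"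
      by (rule sum.mono_neutral_cong_left) (auto simp: profiles_nth)
    also have "\<dots> = (\<Sum>a=1..l. g (item_profile I (\<pi> a)) * of_bool (\<beta> (\<pi> a) = i))"
      by (simp add: sum.atLeast1_atMost_eq)
    also have "\<dots> = (\<Sum>a=1..l. g (item_profile I (\<pi> a)) * x i (\<pi> a))"
    proof (rule sum.cong[OF refl])
      fix a assume "a \<in> {1..l}"
      then have "\<pi> a \<in> {1..items I}" using l unfolding \<pi>_in by auto
      from \<beta>[OF i this] show "g (item_profile I (\<pi> a)) * of_bool (\<beta> (\<pi> a) = i) = g (item_profile I (\<pi> a)) * x i (\<pi> a)"
        by simp
    qed
    finally show ?thesis .
  qed
  have len: "length (cap_list I) = bins I" by simp
  have "(\<Sum>a=1..l. \<Sum>i=1..bins I. worth I i (\<pi> a) * x i (\<pi> a)) =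
      (\<Sum>i=1..bins I. \<Sum>a=1..l. p_value (item_profile I (\<pi> a)) i * x i (\<pi> a))"
    by (subst sum.swap) (intro sum.cong refl, simp)
  also have "\<dots> = packing_value (cap_list I) ?ps ?b"
    unfolding packing_value_def len by (intro sum.cong refl sums[symmetric, where g = "\<lambda>p. p_value p _"])
  also have "\<dots> \<le> packing_value (cap_list I) (packed I \<pi> l) (best_packing (cap_list I) (packed I \<pi> l))"
  proof (rule best_packing_canonical_ge)
    show "cap_list I ! (i - 1) \<ge> 0" if "i \<in> {1..length (cap_list I)}" for i
      using that I unfolding len by (simp add: gap_instance_def less_imp_le del: One_nat_def upt_Suc)
    show "?b \<in> {..<length ?ps} \<rightarrow> {..length (cap_list I)}"
      using \<beta>_le by (simp del: upt_Suc)
    show "(\<Sum>k | k < length ?ps \<and> ?b k = i. p_size (?ps ! k) i) \<le> cap_list I ! (i - 1)"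
      if "i \<in> {1..length (cap_list I)}" for i
    proof -
      have i: "i \<in> {1..bins I}" using that unfolding len .
      have "(\<Sum>k | k < length ?ps \<and> ?b k = i. p_size (?ps ! k) i) = (\<Sum>a=1..l. weight I i (\<pi> a) * x i (\<pi> a))"
        using sums[OF i, of "\<lambda>p. p_size p i"] by (simp only: profile_simps[OF i])
      \<comment> \<open>Items yet to arrive add nonnegative weight, so the restriction of
        \<open>x\<close> inherits its capacity bound.\<close>
      also have "\<dots> \<le> (\<Sum>a=1..items I. weight I i (\<pi> a) * x i (\<pi> a))"
      proof (rule sum_mono2)
        show "0 \<le> weight I i (\<pi> a) * x i (\<pi> a)" if "a \<in> {1..items I} - {1..l}" for a
        proof -
          have "\<pi> a \<in> {1..items I}" using that unfolding \<pi>_in by blast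
          then have "weight I i (\<pi> a) > 0" "x i (\<pi> a) \<ge> 0"
            using I i x01[OF i, of "\<pi> a"] by (auto simp: gap_instance_def simp del: One_nat_def)
          then show ?thesis by simp
        qed
      qed (use l in auto)
      also have "\<dots> = (\<Sum>j=1..items I. weight I i j * x i j)"
        using sum.permute[OF \<pi>, of "\<lambda>j. weight I i j * x i j"] by (simp add: o_def)
      also have "\<dots> \<le> capacity I i"
        using x i unfolding feasible_def by blast
      finally show ?thesis unfolding profile_simps(3)[OF i] .
    qed
  qed
  also have "\<dots> = (\<Sum>i=1..bins I. \<Sum>a=1..l. tentative_prob I (\<pi> \<circ> Transposition.transpose a l) i l * fitting_worth I i (\<pi> a))"
    unfolding packing_value_def len
    by (rule sum.cong[OF refl]) (simp add: sum_fitting_worth_eq[OF I \<pi> l] del: One_nat_def upt_Suc)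
  finally show ?thesis .
qed

text \<open>Each round after the observation phase offers a fraction \<open>1 / n\<close> of the
  optimum, weighted by the lower bound on the probability of free capacity. The factor
  \<open>1 / 2\<close> for the coin is left out.\<close>

definition expected_ratio :: "nat \<Rightarrow> real" where
  "expected_ratio n = (\<Sum>l\<in>{n div 2<..n}. 1 - (\<Sum>l'\<in>{n div 2<..<l}. 1 / real l')) / real n"

text \<open>
  Permuting the first \<open>l'\<close> arrivals changes neither the item of round \<open>l\<close> nor its tentative bin, so
  the round \<open>l'\<close> item may be averaged over the first \<open>l'\<close> arrivals.
\<close>

lemma sum_virtual_load_le:
  assumes I: "gap_instance I" and i: "i \<in> {1..bins I}" and l: "l' \<in> {1..items I}" "l' < l" "l \<le> items I"
  shows "(\<Sum>\<pi> | \<pi> permutes {1..items I}. fitting_worth I i (\<pi> l) * tentative_prob I \<pi> i l *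
      (tentative_prob I \<pi> i l' * weight I i (\<pi> l') / capacity I i)) \<le>
    (\<Sum>\<pi> | \<pi> permutes {1..items I}. fitting_worth I i (\<pi> l) * tentative_prob I \<pi> i l) / l'"
    (is "?lhs \<le> ?rhs")
proof -
  have cap: "capacity I i > 0" using I i by (simp add: gap_instance_def)
  have "?lhs = (\<Sum>\<pi> | \<pi> permutes {1..items I}. \<Sum>a=1..l'. fitting_worth I i (\<pi> l) * tentative_prob I \<pi> i l *
      (tentative_prob I (\<pi> \<circ> Transposition.transpose a l') i l' * weight I i (\<pi> a) / capacity I i)) / l'"
    unfolding sum_permutes_average[OF l(1), of "\<lambda>\<pi>. fitting_worth I i (\<pi> l) * tentative_prob I \<pi> i l *
      (tentative_prob I \<pi> i l' * weight I i (\<pi> l') / capacity I i)"]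
    using l(2) by (intro arg_cong2[where f = "(/)"] sum.cong refl)
      (simp add: tentative_prob_transpose_later transpose_apply_other)
  also have "\<dots> \<le> ?rhs"
  proof (intro divide_right_mono sum_mono)
    fix \<pi> assume "\<pi> \<in> {\<pi>. \<pi> permutes {1..items I}}"
    then have "\<pi> l \<in> {1..items I}" using permutes_in_image[of \<pi> "{1..items I}" l] l by auto
    then have f: "fitting_worth I i (\<pi> l) \<ge> 0"
      using I i by (simp add: fitting_worth_def gap_instance_def less_imp_le)
    have "(\<Sum>a=1..l'. fitting_worth I i (\<pi> l) * tentative_prob I \<pi> i l *
      (tentative_prob I (\<pi> \<circ> Transposition.transpose a l') i l' * weight I i (\<pi> a) / capacity I i)) =
      fitting_worth I i (\<pi> l) * tentative_prob I \<pi> i l *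
      ((\<Sum>a=1..l'. tentative_prob I (\<pi> \<circ> Transposition.transpose a l') i l' * weight I i (\<pi> a)) / capacity I i)"
      unfolding sum_divide_distrib sum_distrib_left ..
    also have "\<dots> \<le> fitting_worth I i (\<pi> l) * tentative_prob I \<pi> i l * 1"
      using f cap sum_tentative_weight_le[OF I i]
      by (intro mult_left_mono) (simp_all add: tentative_prob_def del: upt_Suc)
    finally show "(\<Sum>a=1..l'. fitting_worth I i (\<pi> l) * tentative_prob I \<pi> i l *
      (tentative_prob I (\<pi> \<circ> Transposition.transpose a l') i l' * weight I i (\<pi> a) / capacity I i)) \<le>
      fitting_worth I i (\<pi> l) * tentative_prob I \<pi> i l" by simp
  qed simp
  finally show ?thesis .
qed

text \<open>On average the first \<open>l\<close> arrivals carry the fraction \<open>l / n\<close>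
  of the value of \<open>x\<close>, and the packing of round \<open>l\<close> does at least as well.
  Only one of these \<open>l\<close> items is the current one, which divides by
  \<open>l\<close>.\<close>

lemma sum_fitting_worth_ge:
  assumes I: "gap_instance I" and x: "feasible I x" and l: "l \<in> {1..items I}"
  shows "fact (items I) * assignment_value I x / items I \<le>
    (\<Sum>\<pi> | \<pi> permutes {1..items I}. \<Sum>i=1..bins I. fitting_worth I i (\<pi> l) * tentative_prob I \<pi> i l)"
proof -
  let ?P = "{\<pi>. \<pi> permutes {1..items I}}"
  let ?g = "\<lambda>j. \<Sum>i=1..bins I. worth I i j * x i j"
  have "(\<Sum>\<pi>\<in>?P. \<Sum>a=1..l. ?g (\<pi> a)) = (\<Sum>a=1..l. \<Sum>\<pi>\<in>?P. ?g (\<pi> a))"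
    by (rule sum.swap)
  also have "\<dots> = (\<Sum>a=1..l. fact (items I) * (\<Sum>j=1..items I. ?g j) / items I)"
    using l by (intro sum.cong refl sum_permutes_apply[where g = ?g]) auto
  also have "(\<Sum>j=1..items I. ?g j) = assignment_value I x"
    unfolding assignment_value_def by (rule sum.swap)
  finally have "fact (items I) * assignment_value I x / items I = (\<Sum>\<pi>\<in>?P. \<Sum>a=1..l. ?g (\<pi> a)) / l"
    using l by simp
  also have "\<dots> \<le> (\<Sum>\<pi>\<in>?P. \<Sum>i=1..bins I. \<Sum>a=1..l.
      tentative_prob I (\<pi> \<circ> Transposition.transpose a l) i l * fitting_worth I i (\<pi> a)) / l"
    by (intro divide_right_mono sum_mono sum_tentative_worth_ge) (use I x l in auto)
  also have "\<dots> = (\<Sum>\<pi>\<in>?P. \<Sum>a=1..l. \<Sum>i=1..bins I.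
      fitting_worth I i ((\<pi> \<circ> Transposition.transpose a l) l) * tentative_prob I (\<pi> \<circ> Transposition.transpose a l) i l) / l"
    by (intro arg_cong2[where f = "(/)"] sum.cong[OF refl] refl, subst sum.swap) (simp add: mult.commute)
  also have "\<dots> = (\<Sum>\<pi>\<in>?P. \<Sum>i=1..bins I. fitting_worth I i (\<pi> l) * tentative_prob I \<pi> i l)"
    by (rule sum_permutes_average[OF l, symmetric])
  finally show ?thesis .
qed

text \<open>Combines the two averages: round \<open>l\<close> gains at least a fraction
  \<open>1 / n\<close> of the value of \<open>x\<close>, and every earlier round \<open>l'\<close>
  after the observation phase costs at most a fraction \<open>1 / l'\<close> of that round's
  gain.\<close>

lemma expectation_gap_algorithm_ge:
  assumes I: "gap_instance I" and x: "feasible I x"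
  shows "expected_ratio (items I) / 2 * assignment_value I x \<le>
    measure_pmf.expectation (final_assignment gap_algorithm I) (assignment_value I)"
proof -
  define n where "n = items I"
  let ?P = "{\<pi>. \<pi> permutes {1..n}}"
  let ?G = "\<lambda>i l \<pi>. fitting_worth I i (\<pi> l) * tentative_prob I \<pi> i l"
  let ?R = "\<lambda>i l' \<pi>. tentative_prob I \<pi> i l' * weight I i (\<pi> l') / capacity I i"
  let ?h = "\<lambda>l. \<Sum>l'\<in>{n div 2<..<l}. 1 / real l'"
  \<comment> \<open>Makes the factor \<open>1 - ?h l\<close> nonnegative, so that the lower bound on
    the gain can be multiplied by it. There are at most \<open>n div 2\<close> summands, each at
    most \<open>1 / (n div 2 + 1)\<close>.\<close>
  have h: "?h l \<le> 1" if "l \<in> {n div 2<..n}" for l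
  proof -
    have "?h l \<le> (\<Sum>l'\<in>{n div 2<..<l}. 1 / (n div 2 + 1))"
      by (intro sum_mono divide_left_mono) auto
    also have "\<dots> = (l - Suc (n div 2)) / (n div 2 + 1)" by simp
    also have "\<dots> \<le> 1"
    proof -
      have "l - Suc (n div 2) \<le> n div 2 + 1" using that by auto
      then show ?thesis by (simp add: divide_le_eq_1 del: of_nat_add of_nat_Suc)
    qed
    finally show ?thesis .
  qed
  have "fact n * (expected_ratio n * assignment_value I x) =
      (\<Sum>l\<in>{n div 2<..n}. (1 - ?h l) * (fact n * assignment_value I x / n))"
    using sum_distrib_right[of "\<lambda>l. 1 - ?h l" "{n div 2<..n}" "fact n * assignment_value I x / n"]
    by (simp only: expected_ratio_def times_divide_eq_left times_divide_eq_right mult.left_commute)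
  also have "\<dots> \<le> (\<Sum>l\<in>{n div 2<..n}. (1 - ?h l) * (\<Sum>\<pi>\<in>?P. \<Sum>i=1..bins I. ?G i l \<pi>))"
    using h by (intro sum_mono mult_left_mono sum_fitting_worth_ge[OF I x, folded n_def]) auto
  also have "\<dots> = (\<Sum>i=1..bins I. \<Sum>l\<in>{n div 2<..n}. (\<Sum>\<pi>\<in>?P. ?G i l \<pi>) - (\<Sum>l'\<in>{n div 2<..<l}. (\<Sum>\<pi>\<in>?P. ?G i l \<pi>) / l'))"
  proof -
    have "(1 - ?h l) * (\<Sum>\<pi>\<in>?P. \<Sum>i=1..bins I. ?G i l \<pi>) =
      (\<Sum>i=1..bins I. (\<Sum>\<pi>\<in>?P. ?G i l \<pi>) - (\<Sum>l'\<in>{n div 2<..<l}. (\<Sum>\<pi>\<in>?P. ?G i l \<pi>) / l'))" for l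
    proof -
      have S: "S - (\<Sum>l'\<in>{n div 2<..<l}. S / l') = (1 - ?h l) * S" for S :: real
        by (simp add: left_diff_distrib sum_distrib_right)
      have "(\<Sum>i=1..bins I. (\<Sum>\<pi>\<in>?P. ?G i l \<pi>) - (\<Sum>l'\<in>{n div 2<..<l}. (\<Sum>\<pi>\<in>?P. ?G i l \<pi>) / l')) =
          (\<Sum>i=1..bins I. (1 - ?h l) * (\<Sum>\<pi>\<in>?P. ?G i l \<pi>))"
        by (intro sum.cong refl S)
      also have "\<dots> = (1 - ?h l) * (\<Sum>i=1..bins I. \<Sum>\<pi>\<in>?P. ?G i l \<pi>)"
        by (rule sum_distrib_left[symmetric])
      also have "(\<Sum>i=1..bins I. \<Sum>\<pi>\<in>?P. ?G i l \<pi>) = (\<Sum>\<pi>\<in>?P. \<Sum>i=1..bins I. ?G i l \<pi>)"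
        by (rule sum.swap)
      finally show ?thesis ..
    qed
    then show ?thesis by (subst sum.swap) (intro sum.cong refl)
  qed
  also have "\<dots> \<le> (\<Sum>i=1..bins I. \<Sum>l\<in>{n div 2<..n}. (\<Sum>\<pi>\<in>?P. ?G i l \<pi>) - (\<Sum>l'\<in>{n div 2<..<l}. \<Sum>\<pi>\<in>?P. ?G i l \<pi> * ?R i l' \<pi>))"
    by (intro sum_mono diff_left_mono sum_virtual_load_le[OF I, folded n_def]) auto
  also have "\<dots> = (\<Sum>i=1..bins I. \<Sum>l\<in>{n div 2<..n}. \<Sum>\<pi>\<in>?P. ?G i l \<pi> * (1 - (\<Sum>l'\<in>{n div 2<..<l}. ?R i l' \<pi>)))"
  proof (intro sum.cong refl)
    fix i l
    have "(\<Sum>l'\<in>{n div 2<..<l}. \<Sum>\<pi>\<in>?P. ?G i l \<pi> * ?R i l' \<pi>) = (\<Sum>\<pi>\<in>?P. \<Sum>l'\<in>{n div 2<..<l}. ?G i l \<pi> * ?R i l' \<pi>)"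
      by (rule sum.swap)
    then show "(\<Sum>\<pi>\<in>?P. ?G i l \<pi>) - (\<Sum>l'\<in>{n div 2<..<l}. \<Sum>\<pi>\<in>?P. ?G i l \<pi> * ?R i l' \<pi>) =
        (\<Sum>\<pi>\<in>?P. ?G i l \<pi> * (1 - (\<Sum>l'\<in>{n div 2<..<l}. ?R i l' \<pi>)))"
      by (simp only: right_diff_distrib mult_1_right sum_subtractf sum_distrib_left)
  qed
  also have "\<dots> = (\<Sum>i=1..bins I. \<Sum>\<pi>\<in>?P. \<Sum>l\<in>{n div 2<..n}. ?G i l \<pi> * (1 - (\<Sum>l'\<in>{n div 2<..<l}. ?R i l' \<pi>)))"
    by (rule sum.cong[OF refl], rule sum.swap)
  also have "\<dots> = (\<Sum>\<pi>\<in>?P. \<Sum>i=1..bins I. \<Sum>l\<in>{n div 2<..n}. ?G i l \<pi> * (1 - (\<Sum>l'\<in>{n div 2<..<l}. ?R i l' \<pi>)))"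
    by (rule sum.swap)
  also have "\<dots> \<le> (\<Sum>\<pi>\<in>?P. 2 * measure_pmf.expectation (draws I \<pi> n) (run_value I \<pi>))"
    by (intro sum_mono expectation_run_value_ge[OF I, folded n_def]) simp
  also have "\<dots> = fact n * (2 * measure_pmf.expectation (final_assignment gap_algorithm I) (assignment_value I))"
    unfolding expectation_final_assignment n_def[symmetric] sum_distrib_left[symmetric] by simp
  finally show ?thesis
    by (simp add: n_def)
qed

section \<open>The limit of the ratio\<close>

lemma sum_inverse_eq_harm: "r \<le> n \<Longrightarrow> (\<Sum>l\<in>{r<..n}. 1 / real l) = harm n - harm r"
proof (induction n rule: dec_induct)
  case (step n)
  then have "{r<..Suc n} = insert (Suc n) {r<..n}" by auto
  with step show ?case by (simp add: harm_Suc inverse_eq_divide)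
qed simp

text \<open>Each \<open>1 / l'\<close> occurs for the \<open>n - l'\<close> rounds after
  \<open>l'\<close>, so the sum is that of \<open>n / l' - 1\<close> over \<open>l'\<close> from
  \<open>r + 1\<close> to \<open>n\<close>.\<close>

lemma sum_sum_inverse_eq_harm:
  "r \<le> n \<Longrightarrow> (\<Sum>l\<in>{r<..n}. \<Sum>l'\<in>{r<..<l}. 1 / real l') = real n * (harm n - harm r) - (real n - real r)"
proof (induction n rule: dec_induct)
  case (step n)
  then have "{r<..Suc n} = insert (Suc n) {r<..n}" "{r<..<Suc n} = {r<..n}" by auto
  with step have "(\<Sum>l\<in>{r<..Suc n}. \<Sum>l'\<in>{r<..<l}. 1 / real l') =
      (real n + 1) * (harm n - harm r) - (real n - real r)"
    by (simp add: sum_inverse_eq_harm algebra_simps)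
  also have "harm n = harm (Suc n) - 1 / (real n + 1)"
    by (simp add: harm_Suc inverse_eq_divide add.commute)
  also have "(real n + 1) * (harm (Suc n) - 1 / (real n + 1) - harm r) =
      (real n + 1) * (harm (Suc n) - harm r) - 1"
    by (simp add: diff_divide_distrib right_diff_distrib)
  finally show ?case by simp
qed simp

text \<open>With \<open>r = n div 2\<close> the ratio is
  \<open>2 * (1 - r / n) - (harm n - harm r)\<close>. The Euler-Mascheroni constants cancel, leaving
  \<open>1 + ln (1 / 2)\<close> in the limit.\<close>

lemma expected_ratio_tendsto: "expected_ratio \<longlonglongrightarrow> 1 - ln 2"
proof -
  have half: "(\<lambda>n. real (n div 2) / real n) \<longlonglongrightarrow> 1 / 2"
  proof (rule real_tendsto_sandwich)
    show "eventually (\<lambda>n. 1 / 2 - 1 / real n \<le> real (n div 2) / real n) sequentially"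
      using eventually_gt_at_top[of 0]
    proof eventually_elim
      case (elim n)
      have "1 / 2 - 1 / real n = (real n - 2) / 2 / real n" using elim by (simp add: field_simps)
      also have "\<dots> \<le> real (n div 2) / real n"
      proof (rule divide_right_mono)
        have "real n \<le> 2 * real (n div 2) + 2" by linarith
        then show "(real n - 2) / 2 \<le> real (n div 2)" by simp
      qed simp
      finally show ?case .
    qed
    show "eventually (\<lambda>n. real (n div 2) / real n \<le> 1 / 2) sequentially"
      using eventually_gt_at_top[of 0]
    proof eventually_elim
      case (elim n)
      have "2 * real (n div 2) \<le> real n" by linarith
      then show ?case using elim by (simp add: field_simps)
    qed
    show "(\<lambda>n. 1 / 2 - 1 / real n) \<longlonglongrightarrow> 1 / 2"
      using tendsto_diff[OF tendsto_const lim_1_over_n, of "1 / 2 :: real"] by simp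
  qed simp
  have inf: "filterlim (\<lambda>n :: nat. n div 2) sequentially sequentially"
    unfolding filterlim_at_top
  proof
    fix Z :: nat
    show "eventually (\<lambda>n. Z \<le> n div 2) sequentially"
      using eventually_ge_at_top[of "2 * Z"] by eventually_elim simp
  qed
  let ?f = "\<lambda>n. harm n - ln (real n) :: real"
  have "(\<lambda>n. 2 * (1 - real (n div 2) / real n) - (?f n - ?f (n div 2)) + ln (real (n div 2) / real n))
      \<longlonglongrightarrow> 2 * (1 - 1 / 2) - (euler_mascheroni - euler_mascheroni) + ln (1 / 2)"
    by (intro tendsto_intros half euler_mascheroni_LIMSEQ filterlim_compose[OF euler_mascheroni_LIMSEQ inf]) simp
  moreover have "eventually (\<lambda>n. 2 * (1 - real (n div 2) / real n) - (?f n - ?f (n div 2)) + ln (real (n div 2) / real n)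
      = expected_ratio n) sequentially"
    \<comment> \<open>From 2 on, \<open>n div 2\<close> is positive and the logarithm of the
      quotient splits.\<close>
    using eventually_ge_at_top[of 2]
  proof eventually_elim
    case (elim n)
    have "expected_ratio n = (2 * (real n - real (n div 2)) - real n * (harm n - harm (n div 2))) / real n"
      unfolding expected_ratio_def sum_subtractf by (simp add: sum_sum_inverse_eq_harm of_nat_diff)
    also have "\<dots> = 2 * (1 - real (n div 2) / real n) - (harm n - harm (n div 2))"
      using elim by (simp add: field_simps)
    finally show ?case
      using elim by (simp add: ln_div)
  qed
  ultimately show ?thesis
    by (simp add: ln_div tendsto_cong)
qed

theorem theorem3p1:
  "\<exists>A :: algorithm. always_feasible A \<and> competitive ((1 - ln 2) / 2) A"
proof (intro exI conjI)
  show "always_feasible gap_algorithm" by (rule always_feasible_gap_algorithm)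
  \<comment> \<open>Chosen so that the target ratio minus the error is exactly
    \<open>expected_ratio n / 2\<close>.\<close>
  let ?\<epsilon> = "\<lambda>n. (1 - ln 2) / 2 - expected_ratio n / 2"
  have "?\<epsilon> \<longlonglongrightarrow> (1 - ln 2) / 2 - (1 - ln 2) / 2"
    by (intro tendsto_intros expected_ratio_tendsto) simp
  then have "?\<epsilon> \<in> o(\<lambda>_. 1)"
    by (intro smalloI_tendsto) simp_all
  moreover have "measure_pmf.expectation (final_assignment gap_algorithm I) (assignment_value I)
      \<ge> ((1 - ln 2) / 2 - ?\<epsilon> (items I)) * assignment_value I x"
    if "gap_instance I" "optimal I x" for I x
    using expectation_gap_algorithm_ge[OF that(1), of x] that(2) by (simp add: optimal_def)
  ultimately show "competitive ((1 - ln 2) / 2) gap_algorithm"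
    unfolding competitive_def by blast
qed

end
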